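(* Let $n\ge 2$, let $\mathfrak g$ be the affine Kac-Moody Lie algebra of type $C_n^{(1)}$, and let $k\in I=\{0,1,\dots,n\}$. The $\mathbb{Q}(q)$-vector space $\mathcal F(\Lambda_k)$ is a $\mathcal U_q(\mathfrak g)$-module, where the action of the generators is given as follows: for each $i\in I$, $e_i$ acts by $E_i$, $f_i$ acts by $F_i$, and $q^{h_i}$ acts by the diagonal operator $\mathbf Y\mapsto q^{\,cc_i(\mathbf Y)-cx_i(\mathbf Y)}\,\mathbf Y$ for $\mathbf Y\in\mathcal Y(\Lambda_k)$ (so that $k_i=q^{s_ih_i}$ acts by $T_i$), and $q^d$ acts by $T_d$.
   Context: Conventions: $\mathbb N=\{0,1,2,\dots\}$, $n\ge 2$, $I=\{0,1,\dots,n\}$. Cartan datum. $A=(a_{ij})_{i,j\in I}$ is the Cartan matrix of type $C_n^{(1)}$: $a_{ii}=2$; $a_{01}=-1$, $a_{10}=-2$; $a_{n,n-1}=-1$, $a_{n-1,n}=-2$; $a_{i,i+1}=a_{i+1,i}=-1$ for $1\le i\le n-2$; all other entries are $0$. Let $\mathfrak h=\bigoplus_{i=0}^n\mathbb Q h_i\oplus\mathbb Q d$, with simple roots $\alpha_i\in\mathfrak h^*$ satisfying $\alpha_j(h_i)=a_{ij}$ and $\alpha_i(d)=\delta_{0,i}$. Put $P^\vee=\bigoplus_{i=0}^n\mathbb Z h_i\oplus\mathbb Z d$. Put $s_0=s_n=2$ and $s_i=1$ for $i\neq 0,n$; $q_i=q^{s_i}$ and $k_i=q^{s_ih_i}$.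 Quantum group. $\mathcal U_q(\mathfrak g)$ is the associative $\mathbb Q(q)$-algebra generated by $e_i,f_i$ ($i\in I$) and $q^h$ ($h\in P^\vee$) with relations: $q^0=1$, $q^hq^{h'}=q^{h+h'}$; $q^he_iq^{-h}=q^{\alpha_i(h)}e_i$; $q^hf_iq^{-h}=q^{-\alpha_i(h)}f_i$; $e_if_j-f_je_i=\delta_{ij}\frac{k_i-k_i^{-1}}{q_i-q_i^{-1}}$; and for $i\ne j$, $\sum_{r=0}^{1-a_{ij}}(-1)^r\begin{bmatrix}1-a_{ij}\\ r\end{bmatrix}_{q_i}e_i^{1-a_{ij}-r}e_je_i^r=0$ and the same relation with every $e$ replaced by $f$. Here $[m]_{q_i}=\frac{q_i^m-q_i^{-m}}{q_i-q_i^{-1}}$, $[0]_{q_i}!=1$, $[m]_{q_i}!=[m]_{q_i}[m-1]_{q_i}\cdots[1]_{q_i}$, $\begin{bmatrix}m\\ r\end{bmatrix}_{q_i}=\frac{[m]_{q_i}!}{[r]_{q_i}!\,[m-r]_{q_i}!}$. Young diagrams. For $k\in I$, a Young diagram of charge $k$ is a sequence $\mathbf Y=\{y_l\}_{l\in\mathbb N}$ of integers with $y_l\le y_{l+1}$ for all $l\in\mathbb{N}$ and $y_l=k$ for all $l\gg0$. $\mathcal Y(\Lambda_k)$ is the set of all Young diagrams of charge $k$, and the Fock space is $\mathcal F(\Lambda_k)=\bigoplus_{\mathbf Y\in\mathcal Y(\Lambda_k)}\mathbb Q(q)\,\mathbf Y$. In the $x$-$y$ plane, for $l,l'\in\mathbb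 Z$ the box $\{(x,y): l<x\le l+1,\ l'-1<y\le l'\}$ is coloured by the unique $i\in I$ with $l+l'\equiv\pm i\bmod 2n$. The diagram $\mathbf Y$ is represented by the coloured region $\{(x,y): l\le x\le l+1,\ k\ge y\ge y_l\text{ for some }l\in\mathbb N\}$; thus column $l$ has $k-y_l$ boxes. Corners. If $y_l\ne y_{l+1}$, then $\mathbf Y$ has a concave corner at site $(l+1,y_{l+1})$ and a convex corner at site $(l+1,y_l)$. Also $\mathbf Y$ always has a concave corner at site $(0,y_0)$. A corner at site $(l,y)$ is $i$-coloured ($i\in I$) if $l+y\equiv\pm i\bmod 2n$. Let $cc_i(\mathbf Y)$ and $cx_i(\mathbf Y)$ denote the numbers of $i$-coloured concave and convex corners of $\mathbf Y$, respectively. Operators. For $(l,y)\in\mathbb N\times\mathbb Z$ define linear maps on $\mathcal F(\Lambda_k)$ on basis elements $\mathbf Y$ as follows. If $\mathbf Y$ has a convex corner at $(l,y)$, then $E_{(l,y)}(\mathbf Y)$ is $\mathbf Y$ with this corner (box) removed, i.e. $y_{l-1}=y$ is replaced by $y+1$; otherwise $E_{(l,y)}(\mathbf Y)=0$. If $\mathbf Y$ has a concave corner at $(l,y)$, then $F_{(l,y)}(\mathbf Y)$ is $\mathbf Y$ with a box added there, so with a convex corner at site $(l+1,y-1)$, i.e. $y_l=y$ is replaced by $y-1$; otherwise $F_{(l,y)}(\mathbf Y)=0$. With $i\in I$ such that $l+y\equiv\pm i\bmod 2n$, $T^{\pm}_{(l,y)}(\mathbf Y)$ equals $q_i^{\pm1}\mathbf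 Y$ if $\mathbf Y$ has a concave corner at $(l,y)$, $q_i^{\mp1}\mathbf Y$ if $\mathbf Y$ has a convex corner at $(l,y)$, and $\mathbf Y$ otherwise. Order: $(l,y)>(l',y')$ iff $l+y>l'+y'$. For $i\in I$, with all sites below in $\mathbb N\times\mathbb Z$, $$E_i=\sum_{l+y\equiv\pm i\bmod 2n}\Big(\prod_{(l',y')>(l,y),\ l'+y'\equiv\pm i\bmod 2n}T^+_{(l',y')}\Big)E_{(l,y)},$$ $$F_i=\sum_{l+y\equiv\pm i\bmod 2n}\Big(\prod_{(l',y')<(l,y),\ l'+y'\equiv\pm i\bmod 2n}T^-_{(l',y')}\Big)F_{(l,y)},$$ $$T_i=T_i^+=\prod_{l+y\equiv\pm i\bmod 2n}T^+_{(l,y)},\qquad T_d(\mathbf Y)=q^{-(\text{number of }0\text{-coloured boxes in }\mathbf Y)}\,\mathbf Y.$$ (Applied to a given $\mathbf Y$, only finitely many terms and factors are nontrivial.) *)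

theory Defs
  imports
    "HOL-Computational_Algebra.Polynomial"
    "HOL-Computational_Algebra.Fraction_Field"
    "HOL-Library.Poly_Mapping"
    "HOL-Number_Theory.Cong"
    "HOL-Algebra.QuotRing"
    "HOL-Algebra.Module"
begin

section \<open>The ground field\<close>

type_synonym qfield = "rat poly fract"

definition qvar :: qfield where
  "qvar = Fract [:0, 1:] 1"

definition Qq :: "qfield ring" where
  "Qq = \<lparr>carrier = UNIV, mult = (*), one = 1, zero = 0, add = (+)\<rparr>"

definition qint :: "qfield \<Rightarrow> nat \<Rightarrow> qfield" where
  "qint x m = (x ^ m - inverse x ^ m) / (x - inverse x)"

definition qfact :: "qfield \<Rightarrow> nat \<Rightarrow> qfield" where
  "qfact x m = (\<Prod>j=1..m. qint x j)"

definition qbinom :: "qfield \<Rightarrow> nat \<Rightarrow> nat \<Rightarrow> qfield" where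
  "qbinom x m r = qfact x m / (qfact x r * qfact x (m - r))"


section \<open>Cartan datum of type \<open>C\<^sub>n\<^sup>(\<^sup>1\<^sup>)\<close>\<close>

text \<open>Indices are natural numbers; only \<open>i \<le> n\<close> is meaningful.\<close>

definition cartan :: "nat \<Rightarrow> nat \<Rightarrow> nat \<Rightarrow> int" where
  "cartan n i j =
     (if i = j then 2
      else if (i, j) = (0, 1) then -1
      else if (i, j) = (1, 0) then -2
      else if (i, j) = (n, n - 1) then -1
      else if (i, j) = (n - 1, n) then -2
      else if j = i + 1 \<or> i = j + 1 then -1
      else 0)"

definition symm :: "nat \<Rightarrow> nat \<Rightarrow> nat" where
  "symm n i = (if i = 0 \<or> i = n then 2 else 1)"

definition q_sub :: "nat \<Rightarrow> nat \<Rightarrow> qfield" where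
  "q_sub n i = qvar ^ symm n i"

text \<open>The symbols \<open>h\<^sub>i\<close> and \<open>d\<close>; \<open>P\<^sup>\<or>\<close> is the free abelian group on
  \<open>h\<^sub>0, \<dots>, h\<^sub>n, d\<close>.\<close>

datatype cobasis = H nat | D

definition coweights :: "nat \<Rightarrow> (cobasis \<Rightarrow>\<^sub>0 int) set" where
  "coweights n = {h. Poly_Mapping.keys h \<subseteq> insert D (H ` {..n})}"

text \<open>\<open>\<alpha>\<^sub>j\<close> restricted to \<open>P\<^sup>\<or>\<close>.\<close>

definition simple_root :: "nat \<Rightarrow> nat \<Rightarrow> (cobasis \<Rightarrow>\<^sub>0 int) \<Rightarrow> int" where
  "simple_root n j h =
     (\<Sum>i\<le>n. cartan n i j * Poly_Mapping.lookup h (H i)) +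
     (if j = 0 then Poly_Mapping.lookup h D else 0)"


section \<open>The quantum group\<close>

datatype gen = Gen_e nat | Gen_f nat | Gen_q "cobasis \<Rightarrow>\<^sub>0 int"

definition gens :: "nat \<Rightarrow> gen set" where
  "gens n = Gen_e ` {..n} \<union> Gen_f ` {..n} \<union> Gen_q ` coweights n"

text \<open>Words form the free monoid, written additively so that the convolution product of
  \<open>Poly_Mapping\<close> turns \<open>word \<Rightarrow>\<^sub>0 qfield\<close> into the free associative algebra.\<close>

datatype word = Word (letters: "gen list")

instantiation word :: monoid_add
begin

definition zero_word :: word where
  "0 = Word []"

definition plus_word :: "word \<Rightarrow> word \<Rightarrow> word" where
  "u + v = Word (letters u @ letters v)"

instance
  by standard (simp_all add: zero_word_def plus_word_def)

end

type_synonym free_elem = "word \<Rightarrow>\<^sub>0 qfield"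

definition free_alg :: "nat \<Rightarrow> free_elem ring" where
  "free_alg n =
     \<lparr>carrier = {p. \<forall>w \<in> Poly_Mapping.keys p. set (letters w) \<subseteq> gens n},
      mult = (*), one = 1, zero = 0, add = (+)\<rparr>"

definition scal :: "qfield \<Rightarrow> free_elem" where
  "scal c = Poly_Mapping.single 0 c"

definition gen_elem :: "gen \<Rightarrow> free_elem" where
  "gen_elem g = Poly_Mapping.single (Word [g]) 1"

abbreviation "X_e i \<equiv> gen_elem (Gen_e i)"
abbreviation "X_f i \<equiv> gen_elem (Gen_f i)"
abbreviation "X_q h \<equiv> gen_elem (Gen_q h)"

abbreviation coroot :: "nat \<Rightarrow> cobasis \<Rightarrow>\<^sub>0 int" where
  "coroot i \<equiv> Poly_Mapping.single (H i) 1"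

abbreviation coweight_d :: "cobasis \<Rightarrow>\<^sub>0 int" where
  "coweight_d \<equiv> Poly_Mapping.single D 1"

text \<open>The element \<open>s\<^sub>i h\<^sub>i\<close>, so that \<open>k\<^sub>i\<close> is the generator \<open>q\<^bsup>s\<^sub>i h\<^sub>i\<^esup>\<close>
  and \<open>k\<^sub>i\<^sup>-\<^sup>1\<close> the generator \<open>q\<^bsup>-s\<^sub>i h\<^sub>i\<^esup>\<close>.\<close>

definition sym_coroot :: "nat \<Rightarrow> nat \<Rightarrow> cobasis \<Rightarrow>\<^sub>0 int" where
  "sym_coroot n i = Poly_Mapping.single (H i) (int (symm n i))"

definition serre :: "nat \<Rightarrow> (nat \<Rightarrow> free_elem) \<Rightarrow> nat \<Rightarrow> nat \<Rightarrow> free_elem" where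
  "serre n X i j =
     (let m = nat (1 - cartan n i j) in
        \<Sum>r\<le>m. scal ((-1) ^ r * qbinom (q_sub n i) m r) * X i ^ (m - r) * X j * X i ^ r)"

text \<open>Each relation \<open>u = v\<close> is recorded as the element \<open>u - v\<close> of the free algebra.\<close>

definition relators :: "nat \<Rightarrow> free_elem set" where
  "relators n =
     {X_q 0 - 1} \<union>
     {X_q h * X_q h' - X_q (h + h') | h h'. h \<in> coweights n \<and> h' \<in> coweights n} \<union>
     {X_q h * X_e i * X_q (- h) - scal (qvar powi simple_root n i h) * X_e i
        | h i. h \<in> coweights n \<and> i \<le> n} \<union>
     {X_q h * X_f i * X_q (- h) - scal (qvar powi (- simple_root n i h)) * X_f i
        | h i. h \<in> coweights n \<and> i \<le> n} \<union>
     {X_e i * X_f j - X_f j * X_e i -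
        (if i = j
         then scal (1 / (q_sub n i - inverse (q_sub n i))) *
              (X_q (sym_coroot n i) - X_q (- sym_coroot n i))
         else 0)
        | i j. i \<le> n \<and> j \<le> n} \<union>
     {serre n (\<lambda>i. X_e i) i j | i j. i \<le> n \<and> j \<le> n \<and> i \<noteq> j} \<union>
     {serre n (\<lambda>i. X_f i) i j | i j. i \<le> n \<and> j \<le> n \<and> i \<noteq> j}"

definition rel_ideal :: "nat \<Rightarrow> free_elem set" where
  "rel_ideal n = genideal (free_alg n) (relators n)"

definition U_class :: "nat \<Rightarrow> free_elem \<Rightarrow> free_elem set" where
  "U_class n p = rel_ideal n +>\<^bsub>free_alg n\<^esub> p"

text \<open>\<open>\<U>\<^sub>q(\<gg>)\<close>: the quotient of the free algebra by the two-sided ideal of relations.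
  A scalar \<open>c\<close> acts as multiplication by the class of \<open>c \<cdot> 1\<close>.\<close>

definition Uq :: "nat \<Rightarrow> (qfield, free_elem set) module" where
  "Uq n = (let B = free_alg n Quot rel_ideal n in
     \<lparr>carrier = carrier B, mult = mult B, one = one B, zero = zero B, add = add B,
      smult = (\<lambda>c x. U_class n (scal c) \<otimes>\<^bsub>B\<^esub> x)\<rparr>)"

definition Ue :: "nat \<Rightarrow> nat \<Rightarrow> free_elem set" where
  "Ue n i = U_class n (X_e i)"

definition Uf :: "nat \<Rightarrow> nat \<Rightarrow> free_elem set" where
  "Uf n i = U_class n (X_f i)"

definition Uqh :: "nat \<Rightarrow> (cobasis \<Rightarrow>\<^sub>0 int) \<Rightarrow> free_elem set" where
  "Uqh n h = U_class n (X_q h)"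

definition Uk :: "nat \<Rightarrow> nat \<Rightarrow> free_elem set" where
  "Uk n i = Uqh n (sym_coroot n i)"


section \<open>Modules over associative algebras\<close>

text \<open>The library locale \<^locale>\<open>algebra\<close> is restricted to commutative algebras, and
  \<^locale>\<open>module\<close> to modules over commutative rings.\<close>

locale assoc_algebra = module R A + A?: ring A for R and A +
  assumes smult_mult_left: "\<lbrakk>c \<in> carrier R; x \<in> carrier A; y \<in> carrier A\<rbrakk> \<Longrightarrow>
      (c \<odot>\<^bsub>A\<^esub> x) \<otimes>\<^bsub>A\<^esub> y = c \<odot>\<^bsub>A\<^esub> (x \<otimes>\<^bsub>A\<^esub> y)"
    and smult_mult_right: "\<lbrakk>c \<in> carrier R; x \<in> carrier A; y \<in> carrier A\<rbrakk> \<Longrightarrow>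
      x \<otimes>\<^bsub>A\<^esub> (c \<odot>\<^bsub>A\<^esub> y) = c \<odot>\<^bsub>A\<^esub> (x \<otimes>\<^bsub>A\<^esub> y)"

text \<open>A left \<open>A\<close>-module structure \<open>act\<close> on the \<open>R\<close>-module \<open>V\<close>, for an \<open>R\<close>-algebra \<open>A\<close>.\<close>

locale algebra_module = A: assoc_algebra R A + V: module R V for R and A and V +
  fixes act :: "'b \<Rightarrow> 'e \<Rightarrow> 'e"
  assumes act_closed: "\<lbrakk>a \<in> carrier A; v \<in> carrier V\<rbrakk> \<Longrightarrow> act a v \<in> carrier V"
    and act_add_right: "\<lbrakk>a \<in> carrier A; v \<in> carrier V; w \<in> carrier V\<rbrakk> \<Longrightarrow>
      act a (v \<oplus>\<^bsub>V\<^esub> w) = act a v \<oplus>\<^bsub>V\<^esub> act a w"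
    and act_add_left: "\<lbrakk>a \<in> carrier A; b \<in> carrier A; v \<in> carrier V\<rbrakk> \<Longrightarrow>
      act (a \<oplus>\<^bsub>A\<^esub> b) v = act a v \<oplus>\<^bsub>V\<^esub> act b v"
    and act_mult: "\<lbrakk>a \<in> carrier A; b \<in> carrier A; v \<in> carrier V\<rbrakk> \<Longrightarrow>
      act (a \<otimes>\<^bsub>A\<^esub> b) v = act a (act b v)"
    and act_one: "v \<in> carrier V \<Longrightarrow> act \<one>\<^bsub>A\<^esub> v = v"
    and act_smult_left: "\<lbrakk>c \<in> carrier R; a \<in> carrier A; v \<in> carrier V\<rbrakk> \<Longrightarrow>
      act (c \<odot>\<^bsub>A\<^esub> a) v = c \<odot>\<^bsub>V\<^esub> act a v"
    and act_smult_right: "\<lbrakk>c \<in> carrier R; a \<in> carrier A; v \<in> carrier V\<rbrakk> \<Longrightarrow>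
      act a (c \<odot>\<^bsub>V\<^esub> v) = c \<odot>\<^bsub>V\<^esub> act a v"


section \<open>Young diagrams and the Fock space\<close>

type_synonym diagram = "nat \<Rightarrow> int"
type_synonym fock = "diagram \<Rightarrow>\<^sub>0 qfield"
type_synonym site = "nat \<times> int"

definition diagrams :: "nat \<Rightarrow> diagram set" where
  "diagrams k = {Y. (\<forall>l. Y l \<le> Y (l + 1)) \<and> (\<forall>\<^sub>F l in sequentially. Y l = int k)}"

definition fock_scale :: "qfield \<Rightarrow> fock \<Rightarrow> fock" where
  "fock_scale c v = Poly_Mapping.map ((*) c) v"

text \<open>The \<^const>\<open>mult\<close> and \<^const>\<open>one\<close> fields of a \<open>module\<close> record play no role for a module.\<close>

definition Fock :: "nat \<Rightarrow> (qfield, fock) module" where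
  "Fock k = \<lparr>carrier = {v. Poly_Mapping.keys v \<subseteq> diagrams k},
     mult = undefined, one = undefined, zero = 0, add = (+), smult = fock_scale\<rparr>"

definition linear_ext :: "(diagram \<Rightarrow> fock) \<Rightarrow> fock \<Rightarrow> fock" where
  "linear_ext f v = (\<Sum>Y \<in> Poly_Mapping.keys v. fock_scale (Poly_Mapping.lookup v Y) (f Y))"

definition diag_op :: "(diagram \<Rightarrow> qfield) \<Rightarrow> fock \<Rightarrow> fock" where
  "diag_op c = linear_ext (\<lambda>Y. Poly_Mapping.single Y (c Y))"

definition level :: "site \<Rightarrow> int" where
  "level s = int (fst s) + snd s"

definition has_colour :: "nat \<Rightarrow> nat \<Rightarrow> int \<Rightarrow> bool" where
  "has_colour n i m \<longleftrightarrow> [m = int i] (mod 2 * int n) \<or> [m = - int i] (mod 2 * int n)"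

definition colour :: "nat \<Rightarrow> int \<Rightarrow> nat" where
  "colour n m = (THE i. i \<le> n \<and> has_colour n i m)"

definition concave :: "diagram \<Rightarrow> site \<Rightarrow> bool" where
  "concave Y s \<longleftrightarrow> s = (0, Y 0) \<or> (\<exists>l. Y l \<noteq> Y (l + 1) \<and> s = (l + 1, Y (l + 1)))"

definition convex_corner :: "diagram \<Rightarrow> site \<Rightarrow> bool" where
  "convex_corner Y s \<longleftrightarrow> (\<exists>l. Y l \<noteq> Y (l + 1) \<and> s = (l + 1, Y l))"

definition cc :: "nat \<Rightarrow> nat \<Rightarrow> diagram \<Rightarrow> nat" where
  "cc n i Y = card {s. concave Y s \<and> has_colour n i (level s)}"

definition cx :: "nat \<Rightarrow> nat \<Rightarrow> diagram \<Rightarrow> nat" where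
  "cx n i Y = card {s. convex_corner Y s \<and> has_colour n i (level s)}"


section \<open>The operators\<close>

definition E_site :: "site \<Rightarrow> diagram \<Rightarrow> fock" where
  "E_site s Y = (if convex_corner Y s
     then Poly_Mapping.single (Y(fst s - 1 := snd s + 1)) 1 else 0)"

definition F_site :: "site \<Rightarrow> diagram \<Rightarrow> fock" where
  "F_site s Y = (if concave Y s
     then Poly_Mapping.single (Y(fst s := snd s - 1)) 1 else 0)"

text \<open>The eigenvalue of \<open>T\<^sup>\<plusminus>\<^bsub>s\<^esub>\<close> on the basis vector \<open>Y\<close>; the sign is
  \<open>\<epsilon> = \<plusminus>1\<close>.\<close>

definition T_eigenvalue :: "nat \<Rightarrow> int \<Rightarrow> site \<Rightarrow> diagram \<Rightarrow> qfield" where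
  "T_eigenvalue n \<epsilon> s Y =
     (let x = q_sub n (colour n (level s)) in
      if concave Y s then x powi \<epsilon>
      else if convex_corner Y s then x powi (- \<epsilon>)
      else 1)"

text \<open>The (possibly infinite) product of the commuting diagonal operators
  \<open>T\<^sup>\<plusminus>\<^bsub>s\<^esub>\<close> over \<open>s \<in> S\<close>. On each diagram all but finitely many factors are 1,
  which is the situation covered by \<^const>\<open>Prod_any\<close>; likewise for \<^const>\<open>Sum_any\<close> below.\<close>

definition T_prod :: "nat \<Rightarrow> int \<Rightarrow> site set \<Rightarrow> fock \<Rightarrow> fock" where
  "T_prod n \<epsilon> S = diag_op (\<lambda>Y. Prod_any (\<lambda>s. if s \<in> S then T_eigenvalue n \<epsilon> s Y else 1))"

definition sites :: "nat \<Rightarrow> nat \<Rightarrow> site set" where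
  "sites n i = {s. has_colour n i (level s)}"

definition E_op :: "nat \<Rightarrow> nat \<Rightarrow> fock \<Rightarrow> fock" where
  "E_op n i = linear_ext (\<lambda>Y. Sum_any (\<lambda>s. if s \<in> sites n i
     then T_prod n 1 {s' \<in> sites n i. level s' > level s} (E_site s Y) else 0))"

definition F_op :: "nat \<Rightarrow> nat \<Rightarrow> fock \<Rightarrow> fock" where
  "F_op n i = linear_ext (\<lambda>Y. Sum_any (\<lambda>s. if s \<in> sites n i
     then T_prod n (-1) {s' \<in> sites n i. level s' < level s} (F_site s Y) else 0))"

definition T_op :: "nat \<Rightarrow> nat \<Rightarrow> fock \<Rightarrow> fock" where
  "T_op n i = T_prod n 1 (sites n i)"

definition qh_op :: "nat \<Rightarrow> nat \<Rightarrow> fock \<Rightarrow> fock" where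
  "qh_op n i = diag_op (\<lambda>Y. qvar powi (int (cc n i Y) - int (cx n i Y)))"

text \<open>The pair \<open>(l, l')\<close> stands for the box \<open>l < x \<le> l + 1\<close>, \<open>l' - 1 < y \<le> l'\<close>.\<close>

definition boxes :: "nat \<Rightarrow> diagram \<Rightarrow> site set" where
  "boxes k Y = {(l, l'). Y l < l' \<and> l' \<le> int k}"

definition Td_op :: "nat \<Rightarrow> nat \<Rightarrow> fock \<Rightarrow> fock" where
  "Td_op n k =
     diag_op (\<lambda>Y. qvar powi (- int (card {b \<in> boxes k Y. has_colour n 0 (level b)})))"

end

theory Submission
  imports Defs
begin

text \<open>Record a diagram by the set of levels \<open>l + y\<^sub>l\<close>: a configuration of particles on the integer line.
  A concave corner at level \<open>m\<close> means that \<open>m\<close> is occupied and \<open>m - 1\<close> is not, a convex corner the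
  converse, and \<open>f\<^sub>i\<close>, \<open>e\<^sub>i\<close> move a particle across a level of colour \<open>i\<close>. Two levels of the same colour
  are never adjacent, so \<open>e\<^sub>i, f\<^sub>i, k\<^sub>i\<close> act on an ordered tensor product of two-dimensional and
  trivial modules, and \<open>[e\<^sub>i, f\<^sub>i]\<close> telescopes.

  The Serre relations are not verified on diagrams. They follow from the other relations and local
  nilpotency: with \<open>x\<^sub>0 = e\<^sub>j\<close> and \<open>x\<^sub>N\<^sub>+\<^sub>1 = e\<^sub>i x\<^sub>N - q\<^sub>i\<^bsup>a + 2N\<^esup> x\<^sub>N e\<^sub>i\<close>, \<open>a = a\<^sub>i\<^sub>j\<close>, one has
  \<open>x\<^sub>N f\<^sub>i - f\<^sub>i x\<^sub>N = [N] [a + N - 1] x\<^sub>N\<^sub>-\<^sub>1 k\<^sub>i\<^sup>-\<^sup>1\<close>. On the span of the diagrams with a bounded number of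
  corners of colour \<open>i\<close>, \<open>x\<^sub>N\<close> vanishes for large \<open>N\<close>, and since the coefficient is nonzero for
  \<open>N > 1 - a\<close>, descending in \<open>N\<close> shows that the Serre element \<open>x\<^sub>1\<^sub>-\<^sub>a\<close> vanishes as well.\<close>

section \<open>Linear operators and the action of the free algebra\<close>

text \<open>Descent in N cannot be run on one vector: passing from x_(N+1) to x_N at w uses that
  x_(N+1) vanishes at both k_i w and f_i k_i w. The bound on N must therefore be uniform on a
  subspace stable under f_i and k_i, and this is what the filtration by the number p of corners of
  colour i provides. A move across a level of colour i reverses the corner there and meets no other
  level of that colour, so p is kept and e_i^r vanishes for r > p. A move of another colour changes
  only three neighbouring levels, so p grows by at most 3. Hence e_i^r e_j e_i^s vanishes for all
  large r + s, uniformly in the vector, and every vector lies in some step of the filtration. The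
  same holds with e and f exchanged. For i different from j, the moves of e_i and f_j either exclude
  each other in both orders or are at distance at least two. In the latter case the two orders
  differ by powers of q with exponents s_i a_ij and s_j a_ji, which are equal since the Cartan
  matrix is symmetrizable.\<close>

lemma lookup_fock_scale [simp]:
  "Poly_Mapping.lookup (fock_scale c v) Y = c * Poly_Mapping.lookup v Y"
  by (simp add: fock_scale_def Poly_Mapping.map.rep_eq when_def)

text \<open>\<open>fock\<close> contains combinations of arbitrary integer sequences, not only of
  diagrams. Linearity is treated on the whole type, where no carrier has to be checked; diagrams
  enter through conditions on the support.\<close>

interpretation fock: Modules.module fock_scale
  by standard (auto intro!: poly_mapping_eqI simp: lookup_add algebra_simps)

abbreviation fock_linear :: "(fock \<Rightarrow> fock) \<Rightarrow> bool" where
  "fock_linear \<equiv> Modules.module_hom fock_scale fock_scale"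

abbreviation basis :: "diagram \<Rightarrow> fock" where
  "basis Y \<equiv> Poly_Mapping.single Y 1"

lemma fock_linearI:
  assumes "\<And>u v. f (u + v) = f u + f v" "\<And>c v. f (fock_scale c v) = fock_scale c (f v)"
  shows "fock_linear f"
  by (intro module_hom.intro fock.module_axioms module_hom_axioms.intro assms)

text \<open>The two scalings are fixed in advance because equations such as additivity do not
  mention them, so rewriting could not infer them.\<close>

lemmas fock_linear_simps =
  module_hom.add [where ?s1.0 = fock_scale and ?s2.0 = fock_scale]
  module_hom.scale [where ?s1.0 = fock_scale and ?s2.0 = fock_scale]
  module_hom.zero [where ?s1.0 = fock_scale and ?s2.0 = fock_scale]
  module_hom.neg [where ?s1.0 = fock_scale and ?s2.0 = fock_scale]
  module_hom.diff [where ?s1.0 = fock_scale and ?s2.0 = fock_scale]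
  module_hom.sum [where ?s1.0 = fock_scale and ?s2.0 = fock_scale]

lemma fock_scale_single: "fock_scale c (Poly_Mapping.single Y d) = Poly_Mapping.single Y (c * d)"
  by (rule poly_mapping_eqI) (simp add: lookup_single when_def)

lemma keys_fock_scale: "Poly_Mapping.keys (fock_scale c v) \<subseteq> Poly_Mapping.keys v"
  by (auto simp: in_keys_iff)

lemma poly_mapping_sum_singles:
  "p = (\<Sum>k\<in>Poly_Mapping.keys p. Poly_Mapping.single k (Poly_Mapping.lookup p k))"
  by (rule poly_mapping_eqI)
    (simp add: lookup_sum lookup_single when_def not_in_keys_iff_lookup_eq_zero)

text \<open>Cancellation can shrink the support of a sum of vectors; over a common superset the sums
  can be compared term by term.\<close>

lemma linear_ext_superset:
  assumes "finite S" "Poly_Mapping.keys v \<subseteq> S"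
  shows "linear_ext f v = (\<Sum>Y\<in>S. fock_scale (Poly_Mapping.lookup v Y) (f Y))"
  unfolding linear_ext_def using assms
  by (intro sum.mono_neutral_left) (auto simp: not_in_keys_iff_lookup_eq_zero)

lemma fock_linear_linear_ext: "fock_linear (linear_ext f)"
proof (rule fock_linearI)
  fix u v :: fock
  let ?S = "Poly_Mapping.keys u \<union> Poly_Mapping.keys v"
  have "linear_ext f w = (\<Sum>Y\<in>?S. fock_scale (Poly_Mapping.lookup w Y) (f Y))"
    if "w \<in> {u, v, u + v}" for w
    using that keys_add[of u v] by (intro linear_ext_superset) auto
  then show "linear_ext f (u + v) = linear_ext f u + linear_ext f v"
    by (simp add: lookup_add fock.scale_left_distrib sum.distrib)
next
  fix c and v :: fock
  have "linear_ext f (fock_scale c v) =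
      (\<Sum>Y\<in>Poly_Mapping.keys v. fock_scale (Poly_Mapping.lookup (fock_scale c v) Y) (f Y))"
    by (intro linear_ext_superset keys_fock_scale) simp
  then show "linear_ext f (fock_scale c v) = fock_scale c (linear_ext f v)"
    by (simp add: linear_ext_def fock.scale_sum_right)
qed

lemma linear_ext_single: "linear_ext f (Poly_Mapping.single Y c) = fock_scale c (f Y)"
  by (simp add: linear_ext_superset[of "{Y}"])

lemma linear_ext_basis [simp]: "linear_ext f (basis Y) = f Y"
  by (simp add: linear_ext_single)

lemma fock_linear_diag_op: "fock_linear (diag_op c)"
  unfolding diag_op_def by (rule fock_linear_linear_ext)

lemma diag_op_single [simp]:
  "diag_op c (Poly_Mapping.single Y d) = Poly_Mapping.single Y (c Y * d)"
  by (simp add: diag_op_def linear_ext_single fock_scale_single mult.commute)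

lemma fock_expansion:
  "v = (\<Sum>Y\<in>Poly_Mapping.keys v. fock_scale (Poly_Mapping.lookup v Y) (basis Y))"
  by (subst poly_mapping_sum_singles) (simp add: fock_scale_single)

lemma fock_linear_eqI:
  assumes "fock_linear f" "fock_linear g" "Poly_Mapping.keys v \<subseteq> S"
    and "\<And>Y. Y \<in> S \<Longrightarrow> f (basis Y) = g (basis Y)"
  shows "f v = g v"
proof -
  have "f (\<Sum>Y\<in>Poly_Mapping.keys v. fock_scale (Poly_Mapping.lookup v Y) (basis Y)) =
      g (\<Sum>Y\<in>Poly_Mapping.keys v. fock_scale (Poly_Mapping.lookup v Y) (basis Y))"
    using assms(3,4) by (auto simp: fock_linear_simps assms(1,2) intro!: sum.cong)
  then show ?thesis
    by (simp flip: fock_expansion)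
qed

lemma keys_fock_linear:
  assumes "fock_linear f" "Poly_Mapping.keys v \<subseteq> S"
    and "\<And>Y. Y \<in> S \<Longrightarrow> Poly_Mapping.keys (f (basis Y)) \<subseteq> S'"
  shows "Poly_Mapping.keys (f v) \<subseteq> S'"
proof -
  have "f v = (\<Sum>Y\<in>Poly_Mapping.keys v. fock_scale (Poly_Mapping.lookup v Y) (f (basis Y)))"
    by (subst fock_expansion) (simp add: fock_linear_simps assms(1))
  then show ?thesis
    using keys_sum[of "\<lambda>Y. fock_scale (Poly_Mapping.lookup v Y) (f (basis Y))"
        "Poly_Mapping.keys v"] keys_fock_scale assms(2,3) by fastforce
qed

section \<open>Words and elements of the free algebra as operators\<close>

definition word_op :: "(gen \<Rightarrow> fock \<Rightarrow> fock) \<Rightarrow> word \<Rightarrow> fock \<Rightarrow> fock" where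
  "word_op g w = foldr g (letters w)"

definition free_act :: "(gen \<Rightarrow> fock \<Rightarrow> fock) \<Rightarrow> free_elem \<Rightarrow> fock \<Rightarrow> fock" where
  "free_act g p v =
     (\<Sum>w\<in>Poly_Mapping.keys p. fock_scale (Poly_Mapping.lookup p w) (word_op g w v))"

lemma word_op_zero [simp]: "word_op g 0 v = v"
  by (simp add: word_op_def zero_word_def)

lemma word_op_plus [simp]: "word_op g (u + w) v = word_op g u (word_op g w v)"
  by (simp add: word_op_def plus_word_def)

lemma free_act_superset:
  assumes "finite S" "Poly_Mapping.keys p \<subseteq> S"
  shows "free_act g p v = (\<Sum>w\<in>S. fock_scale (Poly_Mapping.lookup p w) (word_op g w v))"
  unfolding free_act_def using assms
  by (intro sum.mono_neutral_left) (auto simp: not_in_keys_iff_lookup_eq_zero)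

lemma free_act_zero [simp]: "free_act g 0 v = 0"
  by (simp add: free_act_def)

lemma free_act_add: "free_act g (p + q) v = free_act g p v + free_act g q v"
proof -
  let ?S = "Poly_Mapping.keys p \<union> Poly_Mapping.keys q"
  have "free_act g r v = (\<Sum>w\<in>?S. fock_scale (Poly_Mapping.lookup r w) (word_op g w v))"
    if "r \<in> {p, q, p + q}" for r
    using that keys_add[of p q] by (intro free_act_superset) auto
  then show ?thesis
    by (simp add: lookup_add fock.scale_left_distrib sum.distrib)
qed

lemma free_act_uminus: "free_act g (- p) v = - free_act g p v"
  using free_act_add[of g "- p" p v] by (simp add: eq_neg_iff_add_eq_0)

lemma free_act_diff: "free_act g (p - q) v = free_act g p v - free_act g q v"
  using free_act_add[of g p "- q" v] by (simp add: free_act_uminus)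

lemma free_act_sum: "free_act g (sum f S) v = (\<Sum>x\<in>S. free_act g (f x) v)"
  by (induction S rule: infinite_finite_induct) (simp_all add: free_act_add)

lemma free_act_single:
  "free_act g (Poly_Mapping.single w c) v = fock_scale c (word_op g w v)"
  by (simp add: free_act_superset[of "{w}"])

lemma free_act_scal [simp]: "free_act g (scal c) v = fock_scale c v"
  by (simp add: scal_def free_act_single)

lemma free_act_one [simp]: "free_act g 1 v = v"
  by (simp add: free_act_single flip: single_one)

lemma free_act_gen_elem [simp]: "free_act g (gen_elem a) v = g a v"
  by (simp add: gen_elem_def free_act_single word_op_def)

context
  fixes g :: "gen \<Rightarrow> fock \<Rightarrow> fock"
  assumes linear: "\<And>a. fock_linear (g a)"
begin

lemma fock_linear_word_op: "fock_linear (word_op g w)"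
proof -
  have "fock_linear (foldr g as)" for as
  proof (induction as)
    case Nil
    show ?case by (intro fock_linearI) simp_all
  next
    case (Cons a as)
    then show ?case
      by (intro fock_linearI) (simp_all add: fock_linear_simps linear)
  qed
  then show ?thesis by (simp add: word_op_def)
qed

lemma fock_linear_free_act: "fock_linear (free_act g p)"
proof (rule fock_linearI)
  show "free_act g p (u + v) = free_act g p u + free_act g p v" for u v
    by (simp add: free_act_def fock_linear_simps[OF fock_linear_word_op]
        fock.scale_right_distrib sum.distrib)
  show "free_act g p (fock_scale c v) = fock_scale c (free_act g p v)" for c v
    by (simp add: free_act_def fock_linear_simps[OF fock_linear_word_op]
        fock.scale_sum_right mult.commute)
qed

text \<open>The coefficients of \<open>q\<close> must be pulled out through the word operators of
  \<open>p\<close>, which is where linearity of the generators enters. Convolution adds words, and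
  adding words composes their operators.\<close>

lemma free_act_mult: "free_act g (p * q) v = free_act g p (free_act g q v)"
proof -
  let ?P = "Poly_Mapping.keys p" and ?Q = "Poly_Mapping.keys q"
  let ?p = "Poly_Mapping.lookup p" and ?q = "Poly_Mapping.lookup q"
  have "p * q = (\<Sum>w\<in>?P. Poly_Mapping.single w (?p w)) * (\<Sum>u\<in>?Q. Poly_Mapping.single u (?q u))"
    by (simp flip: poly_mapping_sum_singles)
  also have "\<dots> = (\<Sum>w\<in>?P. \<Sum>u\<in>?Q. Poly_Mapping.single (w + u) (?p w * ?q u))"
    by (simp add: sum_distrib_left sum_distrib_right mult_single)
      (rule sum.swap)
  finally have "free_act g (p * q) v =
      (\<Sum>w\<in>?P. \<Sum>u\<in>?Q. fock_scale (?p w * ?q u) (word_op g w (word_op g u v)))"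
    by (simp add: free_act_sum free_act_single)
  also have "\<dots> = free_act g p (free_act g q v)"
    by (simp add: free_act_def fock_linear_simps[OF fock_linear_word_op] fock.scale_sum_right)
  finally show ?thesis .
qed

lemma free_act_power: "free_act g (p ^ m) v = (free_act g p ^^ m) v"
  by (induction m arbitrary: v) (simp_all add: free_act_mult)

end

section \<open>The quotient algebra and its modules\<close>

lemma carrier_free_alg:
  "p \<in> carrier (free_alg n) \<longleftrightarrow> (\<forall>w\<in>Poly_Mapping.keys p. set (letters w) \<subseteq> gens n)"
  by (simp add: free_alg_def)

lemma free_alg_simps [simp]:
  "p \<otimes>\<^bsub>free_alg n\<^esub> q = p * q" "p \<oplus>\<^bsub>free_alg n\<^esub> q = p + q"
  "\<one>\<^bsub>free_alg n\<^esub> = 1" "\<zero>\<^bsub>free_alg n\<^esub> = 0"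
  by (simp_all add: free_alg_def)

lemma free_alg_closed:
  shows free_alg_zero: "0 \<in> carrier (free_alg n)"
    and free_alg_one: "1 \<in> carrier (free_alg n)"
    and free_alg_scal: "scal c \<in> carrier (free_alg n)"
    and free_alg_gen: "a \<in> gens n \<Longrightarrow> gen_elem a \<in> carrier (free_alg n)"
    and free_alg_add: "p \<in> carrier (free_alg n) \<Longrightarrow> q \<in> carrier (free_alg n) \<Longrightarrow>
      p + q \<in> carrier (free_alg n)"
    and free_alg_diff: "p \<in> carrier (free_alg n) \<Longrightarrow> q \<in> carrier (free_alg n) \<Longrightarrow>
      p - q \<in> carrier (free_alg n)"
    and free_alg_mult: "p \<in> carrier (free_alg n) \<Longrightarrow> q \<in> carrier (free_alg n) \<Longrightarrow>
      p * q \<in> carrier (free_alg n)"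
proof -
  show "0 \<in> carrier (free_alg n)" "1 \<in> carrier (free_alg n)" "scal c \<in> carrier (free_alg n)"
    by (simp_all add: carrier_free_alg scal_def zero_word_def)
  show "gen_elem a \<in> carrier (free_alg n)" if "a \<in> gens n"
    using that by (simp add: carrier_free_alg gen_elem_def)
  show "p + q \<in> carrier (free_alg n)" "p - q \<in> carrier (free_alg n)" "p * q \<in> carrier (free_alg n)"
    if "p \<in> carrier (free_alg n)" "q \<in> carrier (free_alg n)"
  proof -
    show "p + q \<in> carrier (free_alg n)"
      using that keys_add[of p q] by (auto simp: carrier_free_alg)
    have "Poly_Mapping.keys (p - q) \<subseteq> Poly_Mapping.keys p \<union> Poly_Mapping.keys q"
      by (auto simp: in_keys_iff lookup_minus)
    then show "p - q \<in> carrier (free_alg n)"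
      using that by (auto simp: carrier_free_alg)
    show "p * q \<in> carrier (free_alg n)"
      using that keys_mult[of p q] unfolding carrier_free_alg
      by (fastforce simp: plus_word_def)
  qed
qed

lemma free_alg_power: "p \<in> carrier (free_alg n) \<Longrightarrow> p ^ m \<in> carrier (free_alg n)"
  by (induction m) (simp_all add: free_alg_one free_alg_mult)

lemma free_alg_sum:
  "(\<And>x. x \<in> S \<Longrightarrow> f x \<in> carrier (free_alg n)) \<Longrightarrow> sum f S \<in> carrier (free_alg n)"
  by (induction S rule: infinite_finite_induct) (simp_all add: free_alg_zero free_alg_add)

lemma ring_free_alg: "ring (free_alg n)"
proof (rule ringI)
  show "abelian_group (free_alg n)"
  proof (rule abelian_groupI)
    show "\<exists>y\<in>carrier (free_alg n). y \<oplus>\<^bsub>free_alg n\<^esub> x = \<zero>\<^bsub>free_alg n\<^esub>"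
      if "x \<in> carrier (free_alg n)" for x
      using free_alg_diff[OF free_alg_zero that] by (intro bexI[of _ "- x"]) simp_all
  qed (simp_all add: free_alg_zero free_alg_add algebra_simps)
  show "Group.monoid (free_alg n)"
    by (rule Group.monoidI) (simp_all add: free_alg_one free_alg_mult mult.assoc)
qed (simp_all add: algebra_simps)

text \<open>Scalars sit on the empty word, which is neutral on both sides. Centrality makes the
  scalar action of \<open>Uq\<close> compatible with the right factor of a product too.\<close>

lemma scal_commute: "scal c * p = p * scal c"
proof -
  have "Poly_Mapping.single 0 c * Poly_Mapping.single w d =
      Poly_Mapping.single w d * Poly_Mapping.single 0 c" for w d
    by (simp add: mult_single mult.commute)
  then have "scal c * (\<Sum>w\<in>Poly_Mapping.keys p. Poly_Mapping.single w (Poly_Mapping.lookup p w)) =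
      (\<Sum>w\<in>Poly_Mapping.keys p. Poly_Mapping.single w (Poly_Mapping.lookup p w)) * scal c"
    unfolding scal_def sum_distrib_left sum_distrib_right by (rule sum.cong[OF refl])
  then show ?thesis by (simp flip: poly_mapping_sum_singles)
qed

lemma scal_add: "scal (c + d) = scal c + scal d"
  by (simp add: scal_def single_add)

lemma scal_mult: "scal (c * d) = scal c * scal d"
  by (simp add: scal_def mult_single)

lemma scal_one [simp]: "scal 1 = 1"
  by (simp add: scal_def)

lemma relators_subset: "relators n \<subseteq> carrier (free_alg n)"
proof -
  have gens: "Gen_e i \<in> gens n" "Gen_f i \<in> gens n" if "i \<le> n" for i
    using that by (auto simp: gens_def)
  have gen_q: "Gen_q h \<in> gens n" if "h \<in> coweights n" for h
    using that by (auto simp: gens_def)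
  have cow: "0 \<in> coweights n" "\<And>h. h \<in> coweights n \<Longrightarrow> - h \<in> coweights n"
    "\<And>i. i \<le> n \<Longrightarrow> sym_coroot n i \<in> coweights n"
    by (auto simp: coweights_def sym_coroot_def in_keys_iff lookup_single when_def split: if_splits)
  have cow_add: "h + h' \<in> coweights n" if "h \<in> coweights n" "h' \<in> coweights n" for h h'
    using that keys_add[of h h'] by (auto simp: coweights_def)
  have serre: "serre n X i j \<in> carrier (free_alg n)"
    if "X i \<in> carrier (free_alg n)" "X j \<in> carrier (free_alg n)" for X i j
    using that unfolding serre_def Let_def
    by (intro free_alg_sum free_alg_mult free_alg_scal free_alg_power)
  show ?thesis
    unfolding relators_def
    by (auto intro!: free_alg_diff free_alg_mult free_alg_scal free_alg_gen free_alg_one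
        free_alg_zero gens gen_q cow cow_add serre)
qed

lemma ideal_rel_ideal: "ideal (rel_ideal n) (free_alg n)"
  unfolding rel_ideal_def
  by (rule ring.genideal_ideal[OF ring_free_alg relators_subset])

text \<open>\<open>Uq n\<close> is a record of another type than the quotient ring, with a scalar
  action added; equality of the ring fields transports the ring laws.\<close>

lemma Uq_simps:
  "carrier (Uq n) = carrier (free_alg n Quot rel_ideal n)"
  "mult (Uq n) = mult (free_alg n Quot rel_ideal n)"
  "one (Uq n) = one (free_alg n Quot rel_ideal n)"
  "zero (Uq n) = zero (free_alg n Quot rel_ideal n)"
  "add (Uq n) = add (free_alg n Quot rel_ideal n)"
  by (simp_all add: Uq_def Let_def)

lemma ring_Uq: "ring (Uq n)"
proof -
  interpret B: ring "free_alg n Quot rel_ideal n"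
    by (rule ideal.quotient_is_ring[OF ideal_rel_ideal])
  show ?thesis
    by (intro ringI abelian_groupI Group.monoidI)
      (use B.a_assoc B.a_comm B.m_assoc B.l_distr B.r_distr B.l_neg in
        \<open>force simp: Uq_simps\<close>)+
qed

lemma U_class_simps:
  assumes "p \<in> carrier (free_alg n)" "q \<in> carrier (free_alg n)"
  shows U_class_closed: "U_class n p \<in> carrier (Uq n)"
    and U_class_mult: "U_class n p \<otimes>\<^bsub>Uq n\<^esub> U_class n q = U_class n (p * q)"
    and U_class_add: "U_class n p \<oplus>\<^bsub>Uq n\<^esub> U_class n q = U_class n (p + q)"
    and U_class_smult: "c \<odot>\<^bsub>Uq n\<^esub> U_class n q = U_class n (scal c * q)"
proof -
  note hom = ideal.rcos_ring_hom[OF ideal_rel_ideal[of n]]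
  show "U_class n p \<in> carrier (Uq n)"
    using ring_hom_closed[OF hom assms(1)] by (simp add: Uq_simps U_class_def)
  show "U_class n p \<otimes>\<^bsub>Uq n\<^esub> U_class n q = U_class n (p * q)"
    using ring_hom_mult[OF hom assms] by (simp add: Uq_simps U_class_def)
  show "U_class n p \<oplus>\<^bsub>Uq n\<^esub> U_class n q = U_class n (p + q)"
    using ring_hom_add[OF hom assms] by (simp add: Uq_simps U_class_def)
  show "c \<odot>\<^bsub>Uq n\<^esub> U_class n q = U_class n (scal c * q)"
    using ring_hom_mult[OF hom free_alg_scal assms(2), of c]
    by (simp add: Uq_def Let_def U_class_def)
qed

lemma U_class_one: "\<one>\<^bsub>Uq n\<^esub> = U_class n 1"
  using ring_hom_one[OF ideal.rcos_ring_hom[OF ideal_rel_ideal[of n]]]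
  by (simp add: Uq_simps U_class_def)

lemma Uq_carrierE:
  assumes "X \<in> carrier (Uq n)"
  obtains p where "p \<in> carrier (free_alg n)" "X = U_class n p"
  using assms by (auto simp: Uq_simps FactRing_def A_RCOSETS_def RCOSETS_def U_class_def a_r_coset_def)

lemma cring_Qq: "cring Qq"
proof (rule cringI)
  show "abelian_group Qq"
  proof (rule abelian_groupI)
    show "\<exists>y\<in>carrier Qq. y \<oplus>\<^bsub>Qq\<^esub> x = \<zero>\<^bsub>Qq\<^esub>" for x
      by (rule bexI[of _ "- x"]) (simp_all add: Qq_def)
  qed (simp_all add: Qq_def algebra_simps)
  show "comm_monoid Qq"
    by (rule comm_monoidI) (simp_all add: Qq_def algebra_simps)
qed (simp_all add: Qq_def algebra_simps)

lemma assoc_algebra_Uq: "assoc_algebra Qq (Uq n)"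
proof -
  interpret U: ring "Uq n" by (rule ring_Uq)
  note [simp] = U_class_closed U_class_mult U_class_add U_class_smult
    free_alg_scal free_alg_add free_alg_mult
  show ?thesis
  proof (intro assoc_algebra.intro assoc_algebra_axioms.intro moduleI cring_Qq
      U.abelian_group_axioms U.ring_axioms)
    fix c d x y
    assume "x \<in> carrier (Uq n)" "y \<in> carrier (Uq n)"
    then obtain p q where pq: "p \<in> carrier (free_alg n)" "x = U_class n p"
        "q \<in> carrier (free_alg n)" "y = U_class n q"
      by (metis Uq_carrierE)
    show "c \<odot>\<^bsub>Uq n\<^esub> (x \<oplus>\<^bsub>Uq n\<^esub> y) = c \<odot>\<^bsub>Uq n\<^esub> x \<oplus>\<^bsub>Uq n\<^esub> c \<odot>\<^bsub>Uq n\<^esub> y"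
      using pq by (simp add: distrib_left)
    show "(c \<odot>\<^bsub>Uq n\<^esub> x) \<otimes>\<^bsub>Uq n\<^esub> y = c \<odot>\<^bsub>Uq n\<^esub> (x \<otimes>\<^bsub>Uq n\<^esub> y)"
      using pq by (simp add: mult.assoc)
    show "x \<otimes>\<^bsub>Uq n\<^esub> (c \<odot>\<^bsub>Uq n\<^esub> y) = c \<odot>\<^bsub>Uq n\<^esub> (x \<otimes>\<^bsub>Uq n\<^esub> y)"
      using pq by simp (metis scal_commute mult.assoc)
  next
    fix c d x
    assume "x \<in> carrier (Uq n)"
    then obtain p where p: "p \<in> carrier (free_alg n)" "x = U_class n p"
      by (metis Uq_carrierE)
    show "c \<odot>\<^bsub>Uq n\<^esub> x \<in> carrier (Uq n)"
      using p by simp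
    show "(c \<oplus>\<^bsub>Qq\<^esub> d) \<odot>\<^bsub>Uq n\<^esub> x = c \<odot>\<^bsub>Uq n\<^esub> x \<oplus>\<^bsub>Uq n\<^esub> d \<odot>\<^bsub>Uq n\<^esub> x"
      using p by (simp add: Qq_def scal_add distrib_right)
    show "(c \<otimes>\<^bsub>Qq\<^esub> d) \<odot>\<^bsub>Uq n\<^esub> x = c \<odot>\<^bsub>Uq n\<^esub> (d \<odot>\<^bsub>Uq n\<^esub> x)"
      using p by (simp add: Qq_def scal_mult mult.assoc)
    show "\<one>\<^bsub>Qq\<^esub> \<odot>\<^bsub>Uq n\<^esub> x = x"
      using p by (simp add: Qq_def)
  qed
qed

section \<open>The Fock space as a module, and passage to the quotient algebra\<close>

lemma carrier_Fock: "v \<in> carrier (Fock k) \<longleftrightarrow> Poly_Mapping.keys v \<subseteq> diagrams k"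
  by (simp add: Fock_def)

lemma Fock_simps [simp]:
  "v \<oplus>\<^bsub>Fock k\<^esub> w = v + w" "\<zero>\<^bsub>Fock k\<^esub> = 0" "c \<odot>\<^bsub>Fock k\<^esub> v = fock_scale c v"
  by (simp_all add: Fock_def)

lemma Fock_closed:
  shows Fock_add: "v \<in> carrier (Fock k) \<Longrightarrow> w \<in> carrier (Fock k) \<Longrightarrow> v + w \<in> carrier (Fock k)"
    and Fock_scale: "v \<in> carrier (Fock k) \<Longrightarrow> fock_scale c v \<in> carrier (Fock k)"
    and Fock_zero: "0 \<in> carrier (Fock k)"
  using keys_add[of v w] keys_fock_scale[of c v] by (auto simp: carrier_Fock)

lemma module_Fock: "module Qq (Fock k)"
proof (intro moduleI cring_Qq abelian_groupI)
  show "\<exists>y\<in>carrier (Fock k). y \<oplus>\<^bsub>Fock k\<^esub> x = \<zero>\<^bsub>Fock k\<^esub>" if "x \<in> carrier (Fock k)" for x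
    using Fock_scale[OF that, of "-1"] by (intro bexI[of _ "- x"]) simp_all
qed (auto simp: Fock_closed Qq_def algebra_simps fock.scale_left_distrib fock.scale_right_distrib)

text \<open>The annihilator of the Fock space in the free algebra is a two-sided ideal. If it
  contains the relators, it contains the ideal they generate, and the free action factors through
  the quotient. What remains of the theorem are operator identities on the Fock space.\<close>

proposition relations_imp_algebra_module:
  assumes linear: "\<And>a. fock_linear (g a)"
    and closed: "\<And>a v. a \<in> gens n \<Longrightarrow> v \<in> carrier (Fock k) \<Longrightarrow> g a v \<in> carrier (Fock k)"
    and relations: "\<And>p v. p \<in> relators n \<Longrightarrow> v \<in> carrier (Fock k) \<Longrightarrow> free_act g p v = 0"
  shows "\<exists>act. algebra_module Qq (Uq n) (Fock k) act \<and>
    (\<forall>a\<in>gens n. \<forall>v\<in>carrier (Fock k). act (U_class n (gen_elem a)) v = g a v)"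
proof -
  let ?V = "carrier (Fock k)" and ?A = "carrier (free_alg n)"
  have word_closed: "foldr g as v \<in> ?V" if "set as \<subseteq> gens n" "v \<in> ?V" for as v
    using that by (induction as) (simp_all add: closed)
  have act_closed: "free_act g p v \<in> ?V" if "p \<in> ?A" "v \<in> ?V" for p v
  proof -
    have "fock_scale (Poly_Mapping.lookup p w) (word_op g w v) \<in> ?V"
      if "w \<in> Poly_Mapping.keys p" for w
      using \<open>p \<in> ?A\<close> \<open>v \<in> ?V\<close> that
      by (auto intro!: Fock_scale word_closed simp: word_op_def carrier_free_alg)
    then have "(\<Sum>w\<in>S. fock_scale (Poly_Mapping.lookup p w) (word_op g w v)) \<in> ?V"
      if "S \<subseteq> Poly_Mapping.keys p" for S
      using that
      by (induction S rule: infinite_finite_induct) (auto intro!: Fock_add Fock_zero)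
    then show ?thesis by (auto simp: free_act_def)
  qed
  \<comment> \<open>Only vectors of the Fock space are tested. \<open>K\<close> is stable under
    right multiplication because \<open>act_closed\<close> keeps the image of a tested vector among
    the tested ones.\<close>
  define K where "K = {p \<in> ?A. \<forall>v\<in>?V. free_act g p v = 0}"
  have "ideal K (free_alg n)"
  proof (rule idealI[OF ring_free_alg])
    interpret ring "free_alg n" by (rule ring_free_alg)
    show "subgroup K (add_monoid (free_alg n))"
    proof (rule add.subgroupI)
      show "\<ominus>\<^bsub>free_alg n\<^esub> p \<in> K" if "p \<in> K" for p
      proof -
        have "- p \<in> ?A" using that free_alg_diff[OF free_alg_zero, of p] by (simp add: K_def)
        moreover from this have "\<ominus>\<^bsub>free_alg n\<^esub> p = - p"
          using that by (intro minus_equality) (simp_all add: K_def)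
        ultimately show ?thesis using that by (simp add: K_def free_act_uminus)
      qed
    qed (use free_alg_zero free_alg_add in \<open>auto simp: K_def free_act_add\<close>)
  qed (auto simp: K_def free_alg_mult free_act_mult linear act_closed
      fock_linear_simps[OF fock_linear_free_act])
  then have "rel_ideal n \<subseteq> K"
    unfolding rel_ideal_def using relators_subset relations
    by (intro ring.genideal_minimal[OF ring_free_alg]) (auto simp: K_def)
  \<comment> \<open>A coset acts through a chosen representative; the choice is harmless because two
    representatives differ by an element of the ideal, hence of \<open>K\<close>.\<close>
  define act where "act X = free_act g (SOME p. p \<in> ?A \<and> X = U_class n p)" for X
  have act_eq: "act (U_class n p) v = free_act g p v" if "p \<in> ?A" "v \<in> ?V" for p v
  proof -
    define p' where "p' = (SOME p'. p' \<in> ?A \<and> U_class n p = U_class n p')"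
    have p': "p' \<in> ?A \<and> U_class n p = U_class n p'"
      unfolding p'_def by (rule someI[of _ p]) (use that in simp)
    interpret ideal "rel_ideal n" "free_alg n" by (rule ideal_rel_ideal)
    have "p' \<in> U_class n p"
      using a_rcos_self[of p'] p' by (simp add: U_class_def)
    then obtain r where "r \<in> rel_ideal n" "p' = r + p"
      by (auto simp: U_class_def a_r_coset_def r_coset_def)
    then show ?thesis
      using \<open>rel_ideal n \<subseteq> K\<close> \<open>v \<in> ?V\<close>
      by (auto simp: act_def p'_def[symmetric] free_act_add K_def)
  qed
  note [simp] = U_class_closed U_class_mult U_class_add U_class_smult U_class_one
    free_alg_scal free_alg_add free_alg_mult free_alg_one act_eq act_closed
    free_act_add free_act_mult[OF linear] fock_linear_simps[OF fock_linear_free_act[OF linear]]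
  have "algebra_module Qq (Uq n) (Fock k) act"
  proof (intro algebra_module.intro algebra_module_axioms.intro assoc_algebra_Uq module_Fock)
    fix X Y v w c
    assume "X \<in> carrier (Uq n)" and V: "v \<in> ?V"
    then obtain p where p: "p \<in> ?A" "X = U_class n p"
      by (metis Uq_carrierE)
    show "act X v \<in> ?V"
      using p V by simp
    show "act X (v \<oplus>\<^bsub>Fock k\<^esub> w) = act X v \<oplus>\<^bsub>Fock k\<^esub> act X w" if "w \<in> ?V"
      using p V that by (simp add: Fock_add)
    show "act (c \<odot>\<^bsub>Uq n\<^esub> X) v = c \<odot>\<^bsub>Fock k\<^esub> act X v"
      using p V by simp
    show "act X (c \<odot>\<^bsub>Fock k\<^esub> v) = c \<odot>\<^bsub>Fock k\<^esub> act X v"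
      using p V by (simp add: Fock_scale)
    assume "Y \<in> carrier (Uq n)"
    then obtain q where q: "q \<in> ?A" "Y = U_class n q"
      by (metis Uq_carrierE)
    show "act (X \<oplus>\<^bsub>Uq n\<^esub> Y) v = act X v \<oplus>\<^bsub>Fock k\<^esub> act Y v"
      using p q V by simp
    show "act (X \<otimes>\<^bsub>Uq n\<^esub> Y) v = act X (act Y v)"
      using p q V by simp
  qed simp
  moreover have "act (U_class n (gen_elem a)) v = g a v" if "a \<in> gens n" "v \<in> ?V" for a v
    using that by (simp add: free_alg_gen)
  ultimately show ?thesis by blast
qed

section \<open>Twisted commutators with a locally nilpotent operator\<close>

lemma powi_diff_inverse_neq_zero:
  fixes q :: "'a :: field"
  assumes "q \<noteq> 0" "\<And>m::int. m \<noteq> 0 \<Longrightarrow> q powi m \<noteq> 1" "m \<noteq> 0"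
  shows "q powi m - q powi (- m) \<noteq> 0"
proof
  assume "q powi m - q powi (- m) = 0"
  then have eq: "q powi m = q powi (- m)" by simp
  have "q powi (m + m) = q powi m * q powi m"
    by (rule power_int_add) (simp add: assms(1))
  also have "\<dots> = q powi (- m) * q powi m"
    using eq by metis
  also have "\<dots> = q powi (- m + m)"
    by (rule power_int_add[symmetric]) (simp add: assms(1))
  finally have "q powi (m + m) = 1" by simp
  then show False using assms(2)[of "m + m"] assms(3) by simp
qed

text \<open>A quantum sl_2-triple on \<open>U\<close>, with \<open>K'\<close> undoing
  \<open>K\<close>, and an operator \<open>x\<close> that is a lowest weight vector of weight
  \<open>a\<close> for the twisted adjoint action: it commutes with \<open>f\<close>. The smaller
  \<open>W\<close> carries the uniform nilpotency bound. Exchanging \<open>e\<close> with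
  \<open>f\<close> and \<open>K\<close> with \<open>K'\<close> gives data of the same kind, so one
  locale serves both families of Serre relations.\<close>

locale adjoint_action =
  fixes e f K K' x :: "fock \<Rightarrow> fock" and U W :: "fock set" and q :: qfield and a :: int
  assumes linear: "fock_linear e" "fock_linear f" "fock_linear K" "fock_linear K'" "fock_linear x"
    and closed: "\<And>v. v \<in> U \<Longrightarrow> e v \<in> U" "\<And>v. v \<in> U \<Longrightarrow> x v \<in> U" "\<And>v. v \<in> U \<Longrightarrow> K v \<in> U"
      "\<And>v. v \<in> U \<Longrightarrow> K' v \<in> U" "\<And>v. v \<in> U \<Longrightarrow> f v \<in> U"
    and U_diff: "\<And>v w. v \<in> U \<Longrightarrow> w \<in> U \<Longrightarrow> v - w \<in> U"
    and U_scale: "\<And>v c. v \<in> U \<Longrightarrow> fock_scale c v \<in> U"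
    and W_subset: "W \<subseteq> U"
    and W_closed: "\<And>v. v \<in> W \<Longrightarrow> f v \<in> W" "\<And>v. v \<in> W \<Longrightarrow> K v \<in> W"
    and q_nonzero: "q \<noteq> 0"
    and q_not_root_of_unity: "\<And>m::int. m \<noteq> 0 \<Longrightarrow> q powi m \<noteq> 1"
    and K'_K: "\<And>v. v \<in> U \<Longrightarrow> K' (K v) = v"
    and K_e: "\<And>v. v \<in> U \<Longrightarrow> K (e v) = fock_scale (q powi 2) (e (K v))"
    and K'_e: "\<And>v. v \<in> U \<Longrightarrow> K' (e v) = fock_scale (q powi (-2)) (e (K' v))"
    and K_x: "\<And>v. v \<in> U \<Longrightarrow> K (x v) = fock_scale (q powi a) (x (K v))"
    and K'_x: "\<And>v. v \<in> U \<Longrightarrow> K' (x v) = fock_scale (q powi (- a)) (x (K' v))"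
    and e_f: "\<And>v. v \<in> U \<Longrightarrow>
      e (f v) = f (e v) + fock_scale (1 / (q - inverse q)) (K v - K' v)"
    and x_f: "\<And>v. v \<in> U \<Longrightarrow> x (f v) = f (x v)"
    and weight: "a \<le> 0"
    and nilpotent: "\<exists>B. \<forall>r s v. v \<in> W \<longrightarrow> r + s \<ge> B \<longrightarrow> (e ^^ r) (x ((e ^^ s) v)) = 0"
begin

fun ad :: "nat \<Rightarrow> fock \<Rightarrow> fock" where
  "ad 0 v = x v"
| "ad (Suc N) v = e (ad N v) - fock_scale (q powi (a + 2 * int N)) (ad N (e v))"

text \<open>The product [N] [a + N - 1] of q-integers. Integer powers are used because a + N - 1 may
  be negative, which \<open>qint\<close> does not admit.\<close>

definition commutator_coeff :: "nat \<Rightarrow> qfield" where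
  "commutator_coeff N = (q powi int N - q powi (- int N)) *
     (q powi (a + int N - 1) - q powi (1 - a - int N)) / (q - inverse q)\<^sup>2"

lemma ad_linear: "fock_linear (ad N)"
proof (induction N)
  case (Suc N)
  show ?case
    by (rule fock_linearI)
      (simp_all add: fock_linear_simps[OF Suc.IH] fock_linear_simps[OF linear(1)] linear(5)
        fock.scale_right_distrib fock.scale_right_diff_distrib mult.commute)
qed (use linear in simp)

lemma ad_closed: "v \<in> U \<Longrightarrow> ad N v \<in> U"
  by (induction N arbitrary: v) (simp_all add: closed U_diff U_scale)

lemma K_ad: "v \<in> U \<Longrightarrow> K (ad N v) = fock_scale (q powi (a + 2 * int N)) (ad N (K v))"
proof (induction N arbitrary: v)
  case (Suc N)
  have "q powi (a + 2 * int (Suc N)) = q powi 2 * q powi (a + 2 * int N)"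
    unfolding power_int_add[OF disjI1[OF q_nonzero], symmetric] by (simp add: algebra_simps)
  with Suc show ?case
    by (simp add: fock_linear_simps linear ad_linear K_e ad_closed closed
        fock.scale_right_diff_distrib mult.commute del: of_nat_Suc)
qed (simp add: K_x)

lemma K'_ad: "v \<in> U \<Longrightarrow> K' (ad N v) = fock_scale (q powi (- (a + 2 * int N))) (ad N (K' v))"
proof (induction N arbitrary: v)
  case (Suc N)
  define R where "R = q powi (- (a + 2 * int N))"
  have "q powi (- (a + 2 * int (Suc N))) = q powi (-2) * R"
    unfolding R_def power_int_add[OF disjI1[OF q_nonzero], symmetric] by (simp add: algebra_simps)
  moreover have "K' (ad N w) = fock_scale R (ad N (K' w))" if "w \<in> U" for w
    using Suc.IH[OF that] by (simp only: R_def)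
  ultimately show ?case
    using Suc.prems
    by (simp add: fock_linear_simps linear ad_linear K'_e ad_closed closed
        fock.scale_right_diff_distrib ac_simps del: of_nat_Suc minus_add_distrib)
qed (simp add: K'_x)

lemma q_diff_nonzero: "q - inverse q \<noteq> 0"
  using powi_diff_inverse_neq_zero[OF q_nonzero q_not_root_of_unity, of 1] by simp

text \<open>This is [N + 1] [a + N] = [N] [a + N - 1] + [a + 2N], the recursion that the induction
  in \<open>ad_f\<close> produces.\<close>

lemma commutator_coeff_Suc:
  "commutator_coeff (Suc N) = commutator_coeff N +
    (q powi (a + 2 * int N) - q powi (- (a + 2 * int N))) / (q - inverse q)"
proof -
  \<comment> \<open>With q^a and q^N replaced by independent nonzero quantities, a rational identity
    remains.\<close>
  define A where "A = q powi a"
  define Q where "Q = q powi int N"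
  define d where "d = q - inverse q"
  have nz: "A \<noteq> 0" "Q \<noteq> 0" "q \<noteq> 0" "d \<noteq> 0"
    using q_nonzero q_diff_nonzero by (simp_all add: A_def Q_def d_def)
  have pows: "q powi (a + int (Suc N) - 1) = A * Q" "q powi (1 - a - int (Suc N)) = 1 / (A * Q)"
    "q powi (a + int N - 1) = A * Q / q" "q powi (1 - a - int N) = q / (A * Q)"
    "q powi int (Suc N) = Q * q" "q powi (- int (Suc N)) = 1 / (Q * q)"
    "q powi (- int N) = 1 / Q"
    "q powi (a + 2 * int N) = A * Q * Q" "q powi (- (a + 2 * int N)) = 1 / (A * Q * Q)"
    using nz(3) by (simp_all add: A_def Q_def power_int_add power_int_diff power_int_minus
        power_int_mult field_simps power2_eq_square)
  have "(Q * q - 1 / (Q * q)) * (A * Q - 1 / (A * Q)) =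
      (Q - 1 / Q) * (A * Q / q - q / (A * Q)) + (A * Q * Q - 1 / (A * Q * Q)) * d"
    using nz(1-3) by (simp add: d_def field_simps)
  then show ?thesis
    unfolding commutator_coeff_def pows Q_def[symmetric] d_def[symmetric] using nz(4)
    by (simp add: add_divide_distrib power2_eq_square)
qed

text \<open>Moving \<open>f\<close> through the outer twisted commutator produces \<open>K\<close>
  and \<open>K'\<close> terms. The twist q^(a + 2N) is the weight of \<open>ad N\<close>, so the
  \<open>K\<close> terms cancel and the \<open>K'\<close> terms add up to [a + 2N]. At N = 0 the
  coefficient is 0, so the truncated index N - 1 does no harm.\<close>

lemma ad_f: "v \<in> U \<Longrightarrow> ad N (f v) = f (ad N v) + fock_scale (commutator_coeff N) (ad (N - 1) (K' v))"
proof (induction N arbitrary: v)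
  case 0
  then show ?case by (simp add: x_f commutator_coeff_def)
next
  case (Suc N)
  define Q where "Q = q powi (a + 2 * int N)"
  define d where "d = 1 / (q - inverse q)"
  have Q_inv: "q powi (- (a + 2 * int N)) = inverse Q"
    by (simp only: Q_def power_int_minus)
  have K_ad': "K (ad N v) = fock_scale Q (ad N (K v))"
    "K' (ad N v) = fock_scale (inverse Q) (ad N (K' v))"
    using Suc.prems by (simp_all only: K_ad K'_ad Q_inv Q_def)
  \<comment> \<open>Moving \<open>K'\<close> past \<open>e\<close> costs q^(-2), which turns the
    twist belonging to \<open>ad N\<close> into the one belonging to \<open>ad (N - 1)\<close>; the
    bracket is then \<open>ad N\<close> again.\<close>
  have shift: "fock_scale (commutator_coeff N) (e (ad (N - 1) (K' v)) -
      fock_scale (Q * q powi (-2)) (ad (N - 1) (e (K' v)))) = fock_scale (commutator_coeff N) (ad N (K' v))"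
  proof (cases N)
    case 0
    then show ?thesis by (simp add: commutator_coeff_def)
  next
    case (Suc M)
    have "Q * q powi (-2) = q powi (a + 2 * int M)"
      using q_nonzero by (simp add: Q_def Suc flip: power_int_add)
    then show ?thesis by (simp add: Suc)
  qed
  have 1: "e (ad N (f v)) = f (e (ad N v)) +
      fock_scale d (fock_scale Q (ad N (K v)) - fock_scale (inverse Q) (ad N (K' v))) +
      fock_scale (commutator_coeff N) (e (ad (N - 1) (K' v)))"
    using Suc.prems
    by (simp add: Suc.IH e_f ad_closed K_ad' fock_linear_simps linear d_def)
  have 2: "ad N (e (f v)) = f (ad N (e v)) +
      fock_scale (commutator_coeff N) (fock_scale (q powi (-2)) (ad (N - 1) (e (K' v)))) +
      fock_scale d (ad N (K v) - ad N (K' v))"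
    using Suc.prems
    by (simp add: Suc.IH e_f K'_e closed fock_linear_simps linear ad_linear d_def)
  have coeff: "commutator_coeff (Suc N) = commutator_coeff N + (Q - inverse Q) * d"
    by (simp only: commutator_coeff_Suc Q_inv Q_def[symmetric] d_def) simp
  have ad_Suc: "ad (Suc N) w = e (ad N w) - fock_scale Q (ad N (e w))" for w
    by (simp only: ad.simps Q_def)
  have "ad (Suc N) (f v) = f (ad (Suc N) v) + fock_scale ((Q - inverse Q) * d) (ad N (K' v)) +
      fock_scale (commutator_coeff N) (e (ad (N - 1) (K' v)) -
        fock_scale (Q * q powi (-2)) (ad (N - 1) (e (K' v))))"
    by (rule poly_mapping_eqI)
      (simp add: 1 2 ad_Suc lookup_add lookup_minus fock_linear_simps linear algebra_simps
        del: ad.simps)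
  then show ?case
    by (simp only: shift coeff fock.scale_left_distrib diff_Suc_1) (simp add: algebra_simps)
qed

text \<open>The factor [a + N - 1] vanishes exactly at N = 1 - a. This is why the descent in
  \<open>ad_vanishes\<close> ends at index 1 - a and goes no lower.\<close>

lemma commutator_coeff_nonzero:
  assumes "N > nat (1 - a)"
  shows "commutator_coeff N \<noteq> 0"
proof -
  have "a + int N - 1 \<noteq> 0" "int N \<noteq> 0" using assms weight by linarith+
  moreover have "1 - a - int N = - (a + int N - 1)" by simp
  ultimately show ?thesis
    unfolding commutator_coeff_def using q_diff_nonzero
    by (metis powi_diff_inverse_neq_zero[OF q_nonzero q_not_root_of_unity] divide_eq_0_iff
        mult_eq_0_iff power_not_zero)
qed

text \<open>Quantum form of a familiar fact: in an integrable sl_2-module, a lowest weight vector of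
  weight a generates a module of dimension 1 - a, so the raising operator to the power 1 - a kills
  it.\<close>

proposition ad_vanishes:
  assumes "v \<in> W"
  shows "ad (nat (1 - a)) v = 0"
proof -
  obtain B where B: "\<And>r s v. v \<in> W \<Longrightarrow> r + s \<ge> B \<Longrightarrow> (e ^^ r) (x ((e ^^ s) v)) = 0"
    using nilpotent by blast
  have e_pow: "fock_linear (e ^^ r)" for r
    by (induction r) (auto intro!: fock_linearI simp: fock_linear_simps linear)
  \<comment> \<open>Expanding one twisted commutator moves a factor \<open>e\<close> to the far left
    or the far right. The total r + N + s is preserved, so everything reduces to N = 0.\<close>
  have "(e ^^ r) (ad N ((e ^^ s) v)) = 0" if "v \<in> W" "r + N + s \<ge> B" for r N s v
    using that
  proof (induction N arbitrary: r s)
    case (Suc N)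
    have "(e ^^ Suc r) (ad N ((e ^^ s) v)) = 0" "(e ^^ r) (ad N ((e ^^ Suc s) v)) = 0"
      using Suc.prems by (intro Suc.IH; simp)+
    then show ?case
      by (simp add: fock_linear_simps e_pow funpow_swap1)
  qed (use B in simp)
  from this[of _ 0 _ 0] have large: "ad N v = 0" if "v \<in> W" "N \<ge> B" for N v
    using that by simp
  \<comment> \<open>Evaluate \<open>ad_f\<close> at \<open>K w\<close>. Both \<open>K w\<close> and
    \<open>f (K w)\<close> lie in \<open>W\<close>, so two of the three terms vanish, and in the
    third \<open>K'\<close> undoes \<open>K\<close>.\<close>
  have descend: "ad M w = 0"
    if zero: "\<And>v. v \<in> W \<Longrightarrow> ad (Suc M) v = 0" and M: "M \<ge> nat (1 - a)" and w: "w \<in> W" for M w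
  proof -
    have "fock_scale (commutator_coeff (Suc M)) (ad M w) = 0"
      using ad_f[of "K w" "Suc M"] w W_subset W_closed zero
      by (simp add: K'_K closed subset_iff fock_linear_simps linear del: ad.simps)
    moreover have "commutator_coeff (Suc M) \<noteq> 0" using M by (intro commutator_coeff_nonzero) simp
    ultimately have "fock_scale (inverse (commutator_coeff (Suc M)) * commutator_coeff (Suc M)) (ad M w) = 0"
      by (metis fock.scale_scale fock.scale_zero_right)
    with \<open>commutator_coeff (Suc M) \<noteq> 0\<close> show ?thesis by simp
  qed
  have "\<forall>w\<in>W. ad M w = 0" if "nat (1 - a) \<le> M" "M \<le> max B (nat (1 - a))" for M
    using that(2,1)
  proof (induction rule: inc_induct)
    case base
    then show ?case using large by (metis descend le_SucI max.cobounded1)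
  next
    case (step M)
    then have "\<forall>w\<in>W. ad (Suc M) w = 0" using le_SucI by blast
    then show ?case using descend[of M] step.prems by blast
  qed
  then show ?thesis using assms by auto
qed

end

section \<open>Colours of levels\<close>

lemma has_colour_iff:
  "has_colour n i m \<longleftrightarrow> 2 * int n dvd m - int i \<or> 2 * int n dvd m + int i"
  by (simp add: has_colour_def cong_iff_dvd_diff)

lemma even_dvd_small_iff:
  assumes "\<bar>x\<bar> < 4 * int n"
  shows "2 * int n dvd x \<longleftrightarrow> x = 0 \<or> x = 2 * int n \<or> x = - 2 * int n"
proof
  assume "2 * int n dvd x"
  then obtain c where c: "x = 2 * int n * c" by blast
  have "\<bar>c\<bar> < 2"
  proof (rule ccontr)
    assume "\<not> \<bar>c\<bar> < 2"
    then have "2 * int n * 2 \<le> 2 * int n * \<bar>c\<bar>" by (intro mult_left_mono) auto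
    then show False using assms c by (simp add: abs_mult)
  qed
  then have "c = 0 \<or> c = 1 \<or> c = -1" by auto
  then show "x = 0 \<or> x = 2 * int n \<or> x = - 2 * int n" using c by auto
qed auto

text \<open>The bound n + 1 admits a representative in [-n, n] together with its two neighbours.
  Then r - i and r + i are smaller than 4n in absolute value, so only the multiples 0, 2n and -2n of
  the period can occur.\<close>

lemma has_colour_shift:
  assumes "n \<ge> 2" "i \<le> n" "\<bar>r\<bar> \<le> int n + 1"
  shows "has_colour n i (2 * int n * t + r) \<longleftrightarrow>
    r = int i \<or> r = int i - 2 * int n \<or> r = - int i \<or> r = 2 * int n - int i"
proof -
  have "2 * int n dvd 2 * int n * t + y \<longleftrightarrow> 2 * int n dvd y" for y
    by (rule dvd_add_right_iff) simp
  then have "has_colour n i (2 * int n * t + r) \<longleftrightarrow>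
      2 * int n dvd r - int i \<or> 2 * int n dvd r + int i"
    unfolding has_colour_iff by (metis add.assoc add_diff_eq)
  also have "\<dots> \<longleftrightarrow> r = int i \<or> r = int i - 2 * int n \<or> r = - int i \<or> r = 2 * int n - int i"
    using assms by (subst (1 2) even_dvd_small_iff) auto
  finally show ?thesis .
qed

lemma has_colourE:
  assumes "has_colour n i m"
  obtains t r where "m = 2 * int n * t + r" "r = int i \<or> r = - int i"
proof -
  from assms obtain c where "m - int i = 2 * int n * c \<or> m + int i = 2 * int n * c"
    by (auto simp: has_colour_iff)
  then show ?thesis
    using that[of c "int i"] that[of c "- int i"] by linarith
qed

lemma has_colour_unique:
  assumes "n \<ge> 2" "i \<le> n" "j \<le> n" "has_colour n i m" "has_colour n j m"
  shows "i = j"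
proof -
  obtain t r where r: "m = 2 * int n * t + r" "r = int j \<or> r = - int j"
    using assms(5) by (rule has_colourE)
  have "r = int i \<or> r = int i - 2 * int n \<or> r = - int i \<or> r = 2 * int n - int i"
    using assms r has_colour_shift[of n i r t] by auto
  then show ?thesis using r(2) assms(1-3) by linarith
qed

lemma colour_eq:
  assumes "n \<ge> 2" "i \<le> n" "has_colour n i m"
  shows "colour n m = i"
  unfolding colour_def
proof (rule the_equality)
  show "j = i" if "j \<le> n \<and> has_colour n j m" for j
    using has_colour_unique[OF assms(1,2)] that assms(3) by blast
qed (use assms in simp)

text \<open>The arithmetic core of the folding, with congruences already resolved: A, B, C stand for
  colour I at the levels r, r - 1, r + 1. The exceptional entries come from the reflections at 0 and
  N.\<close>

lemma folding_count:
  fixes N I J r :: int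
  assumes "N \<ge> 2" "0 \<le> I" "0 \<le> J" "I \<le> N" "J \<le> N" "r = J \<or> r = - J"
    and "A \<longleftrightarrow> r = I \<or> r = I - 2 * N \<or> r = - I \<or> r = 2 * N - I"
    and "B \<longleftrightarrow> r - 1 = I \<or> r - 1 = I - 2 * N \<or> r - 1 = - I \<or> r - 1 = 2 * N - I"
    and "C \<longleftrightarrow> r + 1 = I \<or> r + 1 = I - 2 * N \<or> r + 1 = - I \<or> r + 1 = 2 * N - I"
  shows "2 * of_bool A - of_bool B - of_bool C =
    (if I = J then 2 else if I = 0 \<and> J = 1 then -1 else if I = 1 \<and> J = 0 then -2
     else if I = N \<and> J = N - 1 then -1 else if I = N - 1 \<and> J = N then -2
     else if J = I + 1 \<or> I = J + 1 then -1 else (0::int))"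
  unfolding of_bool_def using assms by (smt (verit))

text \<open>The level line, coloured by folding \<open>\<int>\<close> onto \<open>{0, \<dots>, n}\<close>, turns the Cartan matrix of
  type \<open>A\<^sub>\<infinity>\<close> into that of type \<open>C\<^sub>n\<^sup>(\<^sup>1\<^sup>)\<close>.\<close>

lemma cartan_eq_sum_levels:
  assumes "n \<ge> 2" "i \<le> n" "j \<le> n" "has_colour n j m"
  shows "2 * of_bool (has_colour n i m) - of_bool (has_colour n i (m - 1)) -
    of_bool (has_colour n i (m + 1)) = cartan n i j"
proof -
  obtain t r where r: "m = 2 * int n * t + r" "r = int j \<or> r = - int j"
    using assms(4) by (rule has_colourE)
  have shift: "has_colour n i (m + e) \<longleftrightarrow> r + e = int i \<or> r + e = int i - 2 * int n \<or>
      r + e = - int i \<or> r + e = 2 * int n - int i" if "\<bar>e\<bar> \<le> 1" for e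
  proof -
    have "\<bar>r + e\<bar> \<le> int n + 1" using assms(3) r(2) that by linarith
    then show ?thesis
      unfolding r(1) add.assoc by (rule has_colour_shift[OF assms(1,2)])
  qed
  have "2 * of_bool (has_colour n i m) - of_bool (has_colour n i (m - 1)) -
      of_bool (has_colour n i (m + 1)) =
      (if int i = int j then 2 else if int i = 0 \<and> int j = 1 then -1
       else if int i = 1 \<and> int j = 0 then -2 else if int i = int n \<and> int j = int n - 1 then -1
       else if int i = int n - 1 \<and> int j = int n then -2
       else if int j = int i + 1 \<or> int i = int j + 1 then -1 else (0::int))"
  proof (rule folding_count)
    show "2 \<le> int n" "0 \<le> int i" "0 \<le> int j" "int i \<le> int n" "int j \<le> int n"
      using assms(1-3) by simp_all
    show "r = int j \<or> r = - int j" by (rule r(2))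
  qed (use shift[of 0] shift[of "-1"] shift[of 1] in simp_all)
  also have "\<dots> = cartan n i j"
  proof -
    \<comment> \<open>\<open>n - 1\<close> is natural subtraction in \<open>cartan\<close>; for
      positive n it agrees with the integer one.\<close>
    have "int i = int n - 1 \<longleftrightarrow> i = n - 1" "int j = int n - 1 \<longleftrightarrow> j = n - 1"
      "int j = int i + 1 \<longleftrightarrow> j = i + 1" "int i = int j + 1 \<longleftrightarrow> i = j + 1"
      "int i = 1 \<longleftrightarrow> i = 1" "int j = 1 \<longleftrightarrow> j = 1"
      using assms(1) by linarith+
    then show ?thesis
      by (simp only: cartan_def prod.inject of_nat_eq_iff of_nat_eq_0_iff)
  qed
  finally show ?thesis .
qed

text \<open>The diagonal entry 2 is already attained by the level itself, so neither neighbour can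
  contribute.\<close>

lemma same_colour_not_adjacent:
  assumes "n \<ge> 2" "i \<le> n" "has_colour n i m"
  shows "\<not> has_colour n i (m - 1)" "\<not> has_colour n i (m + 1)"
proof -
  have "2 - of_bool (has_colour n i (m - 1)) - of_bool (has_colour n i (m + 1)) = (2 :: int)"
    using cartan_eq_sum_levels[OF assms(1,2,2,3)] assms(3) by (simp add: cartan_def)
  then show "\<not> has_colour n i (m - 1)" "\<not> has_colour n i (m + 1)"
    by (auto simp: of_bool_def split: if_splits)
qed

lemma cartan_Suc:
  assumes "n \<ge> 2" "i < n"
  shows "cartan n i (Suc i) = (if Suc i = n then -2 else -1)"
    and "cartan n (Suc i) i = (if i = 0 then -2 else -1)"
proof -
  have "i \<noteq> Suc i" "i = n - 1 \<longleftrightarrow> Suc i = n" "Suc i \<noteq> n - 1 \<or> i \<noteq> n" "i \<noteq> n" "Suc i \<noteq> 0"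
    "i = 0 \<Longrightarrow> Suc i \<noteq> n"
    using assms by linarith+
  then show "cartan n i (Suc i) = (if Suc i = n then -2 else -1)"
    "cartan n (Suc i) i = (if i = 0 then -2 else -1)"
    by (auto simp: cartan_def)
qed

lemma cartan_far:
  assumes "Suc i < j" "j \<le> n"
  shows "cartan n i j = 0" "cartan n j i = 0"
  using assms by (simp_all add: cartan_def) linarith+

text \<open>Symmetrizability. It makes the powers of q agree when e_i and f_j are applied in the two
  orders.\<close>

lemma symm_cartan:
  assumes "n \<ge> 2" "i \<le> n" "j \<le> n"
  shows "int (symm n i) * cartan n i j = int (symm n j) * cartan n j i"
proof -
  have "int (symm n i) * cartan n i j = int (symm n j) * cartan n j i" if "i < j" "j \<le> n" for i j
  proof (cases "j = Suc i")
    case True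
    with that assms(1) show ?thesis by (auto simp: symm_def cartan_Suc)
  next
    case False
    with that show ?thesis by (simp add: cartan_far)
  qed
  then show ?thesis using assms(2,3) by (cases i j rule: linorder_cases) auto
qed

section \<open>Diagrams as particle configurations\<close>

text \<open>The Maya diagram of \<open>Y\<close>. For a diagram the levels l + y_l are strictly
  increasing, so distinct columns are distinct particles.\<close>

definition occ :: "diagram \<Rightarrow> int set" where
  "occ Y = range (\<lambda>l. int l + Y l)"

definition wt :: "diagram \<Rightarrow> int \<Rightarrow> int" where
  "wt Y m = of_bool (m \<in> occ Y) - of_bool (m - 1 \<in> occ Y)"

text \<open>A particle hops from m - 1 to m: y_l grows, so a box is removed. The description is
  meaningful only if m - 1 is occupied, and the result is used only when m is also free.\<close>

definition raise :: "int \<Rightarrow> diagram \<Rightarrow> diagram" where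
  "raise m Y = (let l = THE l. int l + Y l = m - 1 in Y(l := Y l + 1))"

definition lower :: "int \<Rightarrow> diagram \<Rightarrow> diagram" where
  "lower m Y = (let l = THE l. int l + Y l = m in Y(l := Y l - 1))"

lemma diagram_mono: "Y \<in> diagrams k \<Longrightarrow> l \<le> l' \<Longrightarrow> Y l \<le> Y l'"
  by (rule lift_Suc_mono_le[of Y]) (simp_all add: diagrams_def)

lemma diagram_strict_mono:
  assumes "Y \<in> diagrams k"
  shows "strict_mono (\<lambda>l. int l + Y l)"
proof (rule strict_monoI)
  show "int l + Y l < int l' + Y l'" if "l < l'" for l l'
    using diagram_mono[OF assms, of l l'] that by simp
qed

lemma diagram_level_eq_iff: "Y \<in> diagrams k \<Longrightarrow> int l + Y l = int l' + Y l' \<longleftrightarrow> l = l'"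
  using strict_mono_eq[OF diagram_strict_mono, of Y k l l'] by simp

lemma occ_iff: "m \<in> occ Y \<longleftrightarrow> (\<exists>l. m = int l + Y l)"
  by (auto simp: occ_def)

lemma strict_mono_eqI:
  fixes f g :: "nat \<Rightarrow> int"
  assumes "strict_mono f" "strict_mono g" "range f = range g"
  shows "f = g"
proof
  show "f l = g l" for l
  proof (induction l rule: less_induct)
    case (less l)
    \<comment> \<open>Stated for any two sequences in order to be used both ways. The value f'(l)
      equals g'(m) for some m, and m < l is impossible because the sequences agree below l.\<close>
    have le: "g' l \<le> f' l"
      if f': "strict_mono f'" and g': "strict_mono g'" and ran: "range f' = range g'"
        and IH: "\<And>m. m < l \<Longrightarrow> f' m = g' m"
      for f' g' :: "nat \<Rightarrow> int"
    proof -
      obtain m where m: "f' l = g' m" using ran by (metis rangeE rangeI)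
      have "\<not> m < l"
        using m f' IH by (metis less_irrefl strict_monoD)
      then show ?thesis using m g' by (simp add: strict_mono_less_eq)
    qed
    from le[of f g] le[of g f] show ?case using assms less by force
  qed
qed

text \<open>Compositions of moves can therefore be compared through occupied levels, without
  following columns.\<close>

lemma occ_eqD:
  assumes "Y \<in> diagrams k" "Y' \<in> diagrams k" "occ Y = occ Y'"
  shows "Y = Y'"
proof
  have "(\<lambda>l. int l + Y l) = (\<lambda>l. int l + Y' l)"
    using assms by (intro strict_mono_eqI diagram_strict_mono) (simp_all add: occ_def)
  then have "int l + Y l = int l + Y' l" for l by (rule fun_cong)
  then show "Y l = Y' l" for l by simp
qed

lemma wt_eq_iff:
  "wt Y m = -1 \<longleftrightarrow> m - 1 \<in> occ Y \<and> m \<notin> occ Y"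
  "wt Y m = 1 \<longleftrightarrow> m \<in> occ Y \<and> m - 1 \<notin> occ Y"
  "wt Y m \<noteq> 0 \<longleftrightarrow> wt Y m = 1 \<or> wt Y m = -1"
  by (simp_all add: wt_def of_bool_def)

text \<open>Levels far up are all occupied and levels below y_0 are all empty, so occupation changes
  only finitely often.\<close>

lemma finite_wt:
  assumes "Y \<in> diagrams k"
  shows "finite {m. wt Y m \<noteq> 0}"
proof -
  obtain N where N: "\<And>l. l \<ge> N \<Longrightarrow> Y l = int k"
    using assms by (auto simp: diagrams_def eventually_sequentially)
  have high: "m \<in> occ Y" if "m \<ge> int N + int k" for m
    unfolding occ_iff using that N[of "nat (m - int k)"] by (intro exI[of _ "nat (m - int k)"]) auto
  have low: "m \<ge> Y 0" if "m \<in> occ Y" for m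
  proof -
    from that obtain l where "m = int l + Y l" by (auto simp: occ_iff)
    then show ?thesis using diagram_mono[OF assms, of 0 l] by simp
  qed
  have "{m. wt Y m \<noteq> 0} \<subseteq> {Y 0..int N + int k}"
  proof
    fix m assume "m \<in> {m. wt Y m \<noteq> 0}"
    then show "m \<in> {Y 0..int N + int k}"
      using high[of m] high[of "m - 1"] low[of m] low[of "m - 1"]
      by (force simp: wt_def of_bool_def split: if_splits)
  qed
  then show ?thesis by (rule finite_subset) simp
qed

lemma the_column:
  assumes "Y \<in> diagrams k" "int l + Y l = m"
  shows "(THE l. int l + Y l = m) = l"
proof (rule the_equality)
  show "l' = l" if "int l' + Y l' = m" for l'
    using that assms(2) diagram_level_eq_iff[OF assms(1), of l' l] by simp
qed (rule assms(2))

lemma raise_eq: "Y \<in> diagrams k \<Longrightarrow> int l + Y l = m - 1 \<Longrightarrow> raise m Y = Y(l := Y l + 1)"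
  by (simp only: raise_def Let_def the_column)

lemma lower_eq: "Y \<in> diagrams k \<Longrightarrow> int l + Y l = m \<Longrightarrow> lower m Y = Y(l := Y l - 1)"
  by (simp only: lower_def Let_def the_column)

lemma occ_fun_upd:
  assumes "Y \<in> diagrams k"
  shows "occ (Y(l := y)) = insert (int l + y) (occ Y - {int l + Y l})"
proof (intro equalityI subsetI)
  fix m assume "m \<in> occ (Y(l := y))"
  then obtain l' where "m = int l' + (Y(l := y)) l'" by (auto simp: occ_iff)
  then show "m \<in> insert (int l + y) (occ Y - {int l + Y l})"
    using diagram_level_eq_iff[OF assms] by (cases "l' = l") (auto simp: occ_iff)
next
  fix m assume m: "m \<in> insert (int l + y) (occ Y - {int l + Y l})"
  show "m \<in> occ (Y(l := y))"
  proof (cases "m = int l + y")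
    case True
    then show ?thesis by (auto simp: occ_iff intro: exI[of _ l])
  next
    case False
    with m obtain l' where "m = int l' + Y l'" "l' \<noteq> l" by (auto simp: occ_iff)
    then show ?thesis by (auto simp: occ_iff intro: exI[of _ l'])
  qed
qed

lemma diagram_fun_upd:
  assumes "Y \<in> diagrams k" "\<And>l'. l = Suc l' \<Longrightarrow> Y l' \<le> y" "y \<le> Y (Suc l)"
  shows "Y(l := y) \<in> diagrams k"
proof -
  have "\<forall>\<^sub>F l' in sequentially. l' > l" by (rule eventually_gt_at_top)
  moreover have "\<forall>\<^sub>F l' in sequentially. Y l' = int k"
    using assms(1) by (simp add: diagrams_def)
  ultimately have "\<forall>\<^sub>F l' in sequentially. (Y(l := y)) l' = int k"
    by eventually_elim simp
  moreover have "(Y(l := y)) l' \<le> (Y(l := y)) (l' + 1)" for l'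
    using assms diagram_mono[OF assms(1), of l' "Suc l'"] by simp
  ultimately show ?thesis by (simp add: diagrams_def)
qed

text \<open>The particle at m - 1 belongs to some column l; if column l + 1 had the same value, its
  particle would occupy m.\<close>

lemma wt_minus_oneE:
  assumes "Y \<in> diagrams k" "wt Y m = -1"
  obtains l where "int l + Y l = m - 1" "Y l < Y (Suc l)"
proof -
  from assms(2) obtain l where l: "int l + Y l = m - 1" and nm: "m \<notin> occ Y"
    by (metis occ_iff wt_eq_iff(1))
  have "Y (Suc l) \<noteq> Y l"
  proof
    assume "Y (Suc l) = Y l"
    then have "int (Suc l) + Y (Suc l) = m" using l by simp
    then show False using nm by (metis occ_iff)
  qed
  then show ?thesis
    using that l diagram_mono[OF assms(1), of l "Suc l"] by force
qed

lemma wt_oneE: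
  assumes "Y \<in> diagrams k" "wt Y m = 1"
  obtains l where "int l + Y l = m" "\<And>l'. l = Suc l' \<Longrightarrow> Y l' < Y l"
proof -
  from assms(2) obtain l where l: "int l + Y l = m" and nm: "m - 1 \<notin> occ Y"
    by (metis occ_iff wt_eq_iff(2))
  have "Y l' < Y l" if "l = Suc l'" for l'
  proof -
    have "Y l' \<noteq> Y l"
    proof
      assume "Y l' = Y l"
      then have "int l' + Y l' = m - 1" using l that by simp
      then show False using nm by (metis occ_iff)
    qed
    then show ?thesis
      using diagram_mono[OF assms(1), of l' l] that by force
  qed
  then show ?thesis using that l by blast
qed

lemma raise:
  assumes "Y \<in> diagrams k" "wt Y m = -1"
  shows raise_closed: "raise m Y \<in> diagrams k"
    and occ_raise: "occ (raise m Y) = insert m (occ Y - {m - 1})"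
proof -
  obtain l where l: "int l + Y l = m - 1" "Y l < Y (Suc l)"
    using assms by (rule wt_minus_oneE)
  have "Y l' \<le> Y l + 1" if "l = Suc l'" for l'
    using diagram_mono[OF assms(1), of l' l] that by simp
  then show "raise m Y \<in> diagrams k"
    unfolding raise_eq[OF assms(1) l(1)] using assms(1) l by (intro diagram_fun_upd) auto
  have "int l + (Y l + 1) = m" using l by simp
  then show "occ (raise m Y) = insert m (occ Y - {m - 1})"
    by (simp only: raise_eq[OF assms(1) l(1)] occ_fun_upd[OF assms(1)] l(1))
qed

lemma lower:
  assumes "Y \<in> diagrams k" "wt Y m = 1"
  shows lower_closed: "lower m Y \<in> diagrams k"
    and occ_lower: "occ (lower m Y) = insert (m - 1) (occ Y - {m})"
proof -
  obtain l where l: "int l + Y l = m" "\<And>l'. l = Suc l' \<Longrightarrow> Y l' < Y l"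
    using assms by (rule wt_oneE) blast
  have "Y l - 1 \<le> Y (Suc l)"
    using diagram_mono[OF assms(1), of l "Suc l"] by simp
  then show "lower m Y \<in> diagrams k"
    unfolding lower_eq[OF assms(1) l(1)] using assms(1) l(2)
    by (intro diagram_fun_upd) fastforce+
  have "int l + (Y l - 1) = m - 1" using l by simp
  then show "occ (lower m Y) = insert (m - 1) (occ Y - {m})"
    by (simp only: lower_eq[OF assms(1) l(1)] occ_fun_upd[OF assms(1)] l(1))
qed

lemma wt_raise:
  assumes "Y \<in> diagrams k" "wt Y m = -1"
  shows "wt (raise m Y) m' =
    wt Y m' + (if m' = m then 2 else if m' = m - 1 \<or> m' = m + 1 then -1 else 0)"
  using assms(2) unfolding wt_eq_iff wt_def occ_raise[OF assms] by (auto simp: of_bool_def)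

lemma wt_lower:
  assumes "Y \<in> diagrams k" "wt Y m = 1"
  shows "wt (lower m Y) m' =
    wt Y m' - (if m' = m then 2 else if m' = m - 1 \<or> m' = m + 1 then -1 else 0)"
  using assms(2) unfolding wt_eq_iff wt_def occ_lower[OF assms] by (auto simp: of_bool_def)

lemma raise_lower:
  assumes "Y \<in> diagrams k" "wt Y m = 1"
  shows "raise m (lower m Y) = Y"
proof (rule occ_eqD)
  have wt: "wt (lower m Y) m = -1" using assms(2) by (simp add: wt_lower[OF assms])
  show "raise m (lower m Y) \<in> diagrams k"
    by (rule raise_closed[OF lower_closed[OF assms] wt])
  show "occ (raise m (lower m Y)) = occ Y"
    using assms(2) wt_eq_iff(2) by (auto simp: occ_raise[OF lower_closed[OF assms] wt] occ_lower[OF assms])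
qed (use assms in simp)

lemma lower_raise:
  assumes "Y \<in> diagrams k" "wt Y m = -1"
  shows "lower m (raise m Y) = Y"
proof (rule occ_eqD)
  have wt: "wt (raise m Y) m = 1" using assms(2) by (simp add: wt_raise[OF assms])
  show "lower m (raise m Y) \<in> diagrams k"
    by (rule lower_closed[OF raise_closed[OF assms] wt])
  show "occ (lower m (raise m Y)) = occ Y"
    using assms(2) wt_eq_iff(1) by (auto simp: occ_lower[OF raise_closed[OF assms] wt] occ_raise[OF assms])
qed (use assms in simp)

text \<open>The site (l + 1, y_l) lies one level above the particle of column l, and the next
  particle lies beyond it because y_(l+1) > y_l. The last two conclusions recover the site from its
  level.\<close>

lemma convex_corner_level:
  assumes "Y \<in> diagrams k" "convex_corner Y s"
  shows "wt Y (level s) = -1" "raise (level s) Y = Y(fst s - 1 := snd s + 1)"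
    "int (fst s - 1) + Y (fst s - 1) = level s - 1"
    "s = (Suc (fst s - 1), Y (fst s - 1))"
proof -
  from assms(2) obtain l where l: "Y l \<noteq> Y (Suc l)" "s = (Suc l, Y l)"
    by (auto simp: convex_corner_def)
  then have lev: "level s - 1 = int l + Y l" by (simp add: level_def)
  have "level s \<noteq> int l' + Y l'" for l'
  proof
    assume eq: "level s = int l' + Y l'"
    then have "int l + Y l < int l' + Y l'" using lev by simp
    then have "l < l'"
      using strict_mono_less[OF diagram_strict_mono[OF assms(1)]] by simp
    then have "int (Suc l) + Y (Suc l) \<le> int l' + Y l'"
      using diagram_mono[OF assms(1), of "Suc l" l'] by simp
    then show False using eq lev l(1) diagram_mono[OF assms(1), of l "Suc l"] by simp
  qed
  then show "wt Y (level s) = -1" using lev by (auto simp: wt_eq_iff occ_iff)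
  show "raise (level s) Y = Y(fst s - 1 := snd s + 1)"
    "int (fst s - 1) + Y (fst s - 1) = level s - 1" "s = (Suc (fst s - 1), Y (fst s - 1))"
    using raise_eq[OF assms(1) lev[symmetric]] l lev by simp_all
qed

lemma concave_level:
  assumes "Y \<in> diagrams k" "concave Y s"
  shows "wt Y (level s) = 1" "lower (level s) Y = Y(fst s := snd s - 1)"
    "int (fst s) + Y (fst s) = level s" "s = (fst s, Y (fst s))"
proof -
  obtain l where l: "s = (l, Y l)" "\<And>l'. l = Suc l' \<Longrightarrow> Y l' \<noteq> Y l"
    using assms(2) by (auto simp: concave_def)
  then have lev: "level s = int l + Y l" by (simp add: level_def)
  have "level s - 1 \<noteq> int l' + Y l'" for l'
  proof
    assume eq: "level s - 1 = int l' + Y l'"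
    then have "int l' + Y l' < int l + Y l" using lev by simp
    then have "l' < l"
      using strict_mono_less[OF diagram_strict_mono[OF assms(1)]] by simp
    then obtain p where p: "l = Suc p" "l' \<le> p" by (cases l) auto
    have "int l' + Y l' \<le> int p + Y p"
      using p(2) diagram_mono[OF assms(1), of l' p] by simp
    then show False using eq lev l(2)[OF p(1)] p(1) diagram_mono[OF assms(1), of p l] by simp
  qed
  then show "wt Y (level s) = 1" using lev by (auto simp: wt_eq_iff occ_iff)
  show "lower (level s) Y = Y(fst s := snd s - 1)"
    "int (fst s) + Y (fst s) = level s" "s = (fst s, Y (fst s))"
    using lower_eq[OF assms(1) lev[symmetric]] l lev by simp_all
qed

text \<open>A level determines the column of its particle and hence the site of its corner. Sums and
  products over sites in the plane thus become sums and products over the level line.\<close>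

lemma bij_betw_level:
  assumes "Y \<in> diagrams k"
  shows bij_convex: "bij_betw level {s. convex_corner Y s} {m. wt Y m = -1}"
    and bij_concave: "bij_betw level {s. concave Y s} {m. wt Y m = 1}"
    and bij_corners: "bij_betw level {s. concave Y s \<or> convex_corner Y s} {m. wt Y m \<noteq> 0}"
proof -
  have inj: "inj_on level {s. convex_corner Y s}" "inj_on level {s. concave Y s}"
    using convex_corner_level(3,4)[OF assms] concave_level(3,4)[OF assms]
      diagram_level_eq_iff[OF assms]
    by (metis (mono_tags, lifting) inj_onI mem_Collect_eq)+
  have "\<exists>s. convex_corner Y s \<and> level s = m" if m: "wt Y m = -1" for m
    using assms m
  proof (rule wt_minus_oneE)
    fix l assume "int l + Y l = m - 1" "Y l < Y (Suc l)"
    then show ?thesis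
      by (intro exI[of _ "(Suc l, Y l)"]) (auto simp: convex_corner_def level_def)
  qed
  then show convex: "bij_betw level {s. convex_corner Y s} {m. wt Y m = -1}"
    using inj convex_corner_level(1)[OF assms] by (force simp: bij_betw_def)
  have "\<exists>s. concave Y s \<and> level s = m" if m: "wt Y m = 1" for m
    using assms m
  proof (rule wt_oneE)
    fix l assume l: "int l + Y l = m" "\<And>l'. l = Suc l' \<Longrightarrow> Y l' < Y l"
    have "concave Y (l, Y l)"
      using l(2) by (cases l) (force simp: concave_def)+
    then show ?thesis using l(1)
      by (intro exI[of _ "(l, Y l)"]) (auto simp: level_def)
  qed
  then show concave: "bij_betw level {s. concave Y s} {m. wt Y m = 1}"
    using inj concave_level(1)[OF assms] by (force simp: bij_betw_def)
  have "bij_betw level ({s. concave Y s} \<union> {s. convex_corner Y s}) ({m. wt Y m = 1} \<union> {m. wt Y m = -1})"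
    by (rule bij_betw_combine[OF concave convex]) auto
  moreover have "{m. wt Y m \<noteq> 0} = {m. wt Y m = 1} \<union> {m. wt Y m = -1}"
    using wt_eq_iff(3) by blast
  ultimately show "bij_betw level {s. concave Y s \<or> convex_corner Y s} {m. wt Y m \<noteq> 0}"
    by (simp add: Collect_disj_eq)
qed

text \<open>The signed count of corners on selected levels: the exponent of q_i in the eigenvalue of
  a product of operators T^+ of colour i.\<close>

definition wsum :: "(int \<Rightarrow> bool) \<Rightarrow> diagram \<Rightarrow> int" where
  "wsum P Y = (\<Sum>m | wt Y m \<noteq> 0 \<and> P m. wt Y m)"

lemma wsum_superset:
  assumes "finite L" "\<And>m. wt Y m \<noteq> 0 \<Longrightarrow> P m \<Longrightarrow> m \<in> L"
  shows "wsum P Y = (\<Sum>m\<in>L. of_bool (P m) * wt Y m)"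
proof -
  have "wsum P Y = (\<Sum>m | wt Y m \<noteq> 0 \<and> P m. of_bool (P m) * wt Y m)"
    unfolding wsum_def by (rule sum.cong) auto
  also have "\<dots> = (\<Sum>m\<in>L. of_bool (P m) * wt Y m)"
    using assms by (intro sum.mono_neutral_left) auto
  finally show ?thesis .
qed

text \<open>A hop changes \<open>wt\<close> by -1, 2, -1 at m - 1, m, m + 1, a row of the Cartan
  matrix of type A_infinity.\<close>

lemma wsum_raise:
  assumes "Y \<in> diagrams k" "wt Y m = -1"
  shows "wsum P (raise m Y) = wsum P Y + 2 * of_bool (P m) - of_bool (P (m - 1)) - of_bool (P (m + 1))"
proof -
  define L where "L = {m'. wt Y m' \<noteq> 0} \<union> {m - 1, m, m + 1}"
  define d :: "int \<Rightarrow> int" where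
    "d m' = (if m' = m then 2 else if m' = m - 1 \<or> m' = m + 1 then -1 else 0)" for m'
  have "finite L" using finite_wt[OF assms(1)] by (simp add: L_def)
  have "wsum P (raise m Y) = (\<Sum>m'\<in>L. of_bool (P m') * wt (raise m Y) m')"
    by (rule wsum_superset[OF \<open>finite L\<close>]) (auto simp: L_def wt_raise[OF assms] split: if_splits)
  also have "\<dots> = (\<Sum>m'\<in>L. of_bool (P m') * wt Y m') + (\<Sum>m'\<in>L. of_bool (P m') * d m')"
    by (simp add: wt_raise[OF assms] d_def distrib_left sum.distrib)
  also have "(\<Sum>m'\<in>L. of_bool (P m') * wt Y m') = wsum P Y"
    by (rule wsum_superset[symmetric, OF \<open>finite L\<close>]) (auto simp: L_def)
  also have "(\<Sum>m'\<in>L. of_bool (P m') * d m') = (\<Sum>m'\<in>{m - 1, m, m + 1}. of_bool (P m') * d m')"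
    using \<open>finite L\<close> by (intro sum.mono_neutral_right) (auto simp: L_def d_def)
  also have "\<dots> = 2 * of_bool (P m) - of_bool (P (m - 1)) - of_bool (P (m + 1))"
    by (simp add: d_def)
  finally show ?thesis by simp
qed

lemma wsum_lower:
  assumes "Y \<in> diagrams k" "wt Y m = 1"
  shows "wsum P (lower m Y) = wsum P Y - 2 * of_bool (P m) + of_bool (P (m - 1)) + of_bool (P (m + 1))"
  using wsum_raise[OF lower_closed[OF assms], of m P] wt_lower[OF assms, of m]
  by (simp add: assms raise_lower[OF assms])

section \<open>The operators on basis vectors\<close>

text \<open>A positive power of the indeterminate has positive degree. So q is not a root of unity,
  on which the nonvanishing of q-integers rests.\<close>

lemma qvar_power_neq_one:
  assumes "m > 0"
  shows "qvar ^ m \<noteq> 1"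
proof
  have "qvar ^ m = Fract ([:0, 1:] ^ m) 1" for m
    by (induction m) (simp_all add: qvar_def One_fract_def)
  moreover assume "qvar ^ m = 1"
  ultimately have "[:0, 1 :: rat:] ^ m = 1"
    by (simp add: One_fract_def eq_fract)
  then have "degree ([:0, 1 :: rat:] ^ m) = 0" by simp
  then show False using assms by (simp add: degree_linear_power)
qed

lemma qvar_nonzero: "qvar \<noteq> 0"
  by (simp add: qvar_def Zero_fract_def eq_fract)

lemma qvar_powi_neq_one: "m \<noteq> 0 \<Longrightarrow> qvar powi m \<noteq> 1"
proof (cases m rule: int_cases2)
  case (nonneg k)
  then show "m \<noteq> 0 \<Longrightarrow> ?thesis" using qvar_power_neq_one[of k] by simp
next
  case (nonpos k)
  then show "m \<noteq> 0 \<Longrightarrow> ?thesis"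
    using qvar_power_neq_one[of k] by (simp add: power_int_minus)
qed

lemma q_sub_powi: "q_sub n i powi m = qvar powi (int (symm n i) * m)"
  by (simp add: q_sub_def power_int_mult)

lemma q_sub_nonzero: "q_sub n i \<noteq> 0"
  by (simp add: q_sub_def qvar_nonzero)

lemma q_sub_powi_neq_one: "m \<noteq> 0 \<Longrightarrow> q_sub n i powi m \<noteq> 1"
  unfolding q_sub_powi by (rule qvar_powi_neq_one) (simp add: symm_def)

lemma q_sub_diff_nonzero: "q_sub n i - inverse (q_sub n i) \<noteq> 0"
  using powi_diff_inverse_neq_zero[OF q_sub_nonzero q_sub_powi_neq_one, of 1 n i] by simp

lemma prod_powi:
  "x \<noteq> 0 \<Longrightarrow> (\<Prod>a\<in>S. x powi f a) = x powi (\<Sum>a\<in>S. f a)" for x :: "'a :: field"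
  by (induction S rule: infinite_finite_induct) (simp_all add: power_int_add)

lemma bij_betw_Collect_restrict:
  "bij_betw f {a. P a} {b. Q b} \<Longrightarrow> bij_betw f {a. P a \<and> R (f a)} {b. Q b \<and> R b}"
  by (auto simp: bij_betw_def inj_on_def)

lemma Prod_any_T_eigenvalue:
  assumes "n \<ge> 2" "i \<le> n" "Y \<in> diagrams k"
  shows "Prod_any (\<lambda>s. if has_colour n i (level s) \<and> P (level s) then T_eigenvalue n \<epsilon> s Y else 1) =
    q_sub n i powi (\<epsilon> * wsum (\<lambda>m. has_colour n i m \<and> P m) Y)"
    (is "Prod_any ?T = _")
proof -
  let ?S = "{s. (concave Y s \<or> convex_corner Y s) \<and> has_colour n i (level s) \<and> P (level s)}"
  let ?L = "{m. wt Y m \<noteq> 0 \<and> has_colour n i m \<and> P m}"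
  have bij: "bij_betw level ?S ?L"
    by (rule bij_betw_Collect_restrict[OF bij_corners[OF assms(3)]])
  have "finite ?L" by (rule finite_subset[OF _ finite_wt[OF assms(3)]]) blast
  then have "finite ?S" using bij_betw_finite[OF bij] by simp
  have "?T s = q_sub n i powi (\<epsilon> * wt Y (level s))" if "s \<in> ?S" for s
    using that convex_corner_level(1)[OF assms(3), of s] concave_level(1)[OF assms(3), of s]
    by (auto simp: T_eigenvalue_def colour_eq[OF assms(1,2)] Let_def)
  moreover have "{s. ?T s \<noteq> 1} \<subseteq> ?S"
    by (auto simp: T_eigenvalue_def Let_def split: if_splits)
  ultimately have "Prod_any ?T = (\<Prod>s\<in>?S. q_sub n i powi (\<epsilon> * wt Y (level s)))"
    using \<open>finite ?S\<close> by (simp add: Prod_any.expand_superset)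
  also have "\<dots> = (\<Prod>m\<in>?L. q_sub n i powi (\<epsilon> * wt Y m))"
    by (rule prod.reindex_bij_betw[OF bij])
  also have "\<dots> = q_sub n i powi (\<epsilon> * wsum (\<lambda>m. has_colour n i m \<and> P m) Y)"
    by (simp add: prod_powi q_sub_nonzero wsum_def sum_distrib_left)
  finally show ?thesis .
qed

lemma T_prod_single:
  assumes "n \<ge> 2" "i \<le> n" "Y \<in> diagrams k"
  shows "T_prod n \<epsilon> {s \<in> sites n i. P (level s)} (Poly_Mapping.single Y c) =
    Poly_Mapping.single Y (q_sub n i powi (\<epsilon> * wsum (\<lambda>m. has_colour n i m \<and> P m) Y) * c)"
  using Prod_any_T_eigenvalue[OF assms, of P \<epsilon>] by (simp add: T_prod_def sites_def)

text \<open>In \<open>E_op\<close> the factors T^+ act after the box is removed, so their exponent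
  belongs to the new diagram. It is taken at \<open>Y\<close> here; \<open>wsum_beyond_move\<close>
  shows that the two agree.\<close>

definition e_term :: "nat \<Rightarrow> nat \<Rightarrow> int \<Rightarrow> diagram \<Rightarrow> fock" where
  "e_term n i m Y = (if wt Y m = -1 then Poly_Mapping.single (raise m Y)
     (q_sub n i powi wsum (\<lambda>m'. has_colour n i m' \<and> m' > m) Y) else 0)"

definition f_term :: "nat \<Rightarrow> nat \<Rightarrow> int \<Rightarrow> diagram \<Rightarrow> fock" where
  "f_term n i m Y = (if wt Y m = 1 then Poly_Mapping.single (lower m Y)
     (q_sub n i powi (- wsum (\<lambda>m'. has_colour n i m' \<and> m' < m) Y)) else 0)"

lemma wsum_beyond_move:
  assumes "n \<ge> 2" "i \<le> n" "Y \<in> diagrams k" "has_colour n i m"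
  shows "wt Y m = -1 \<Longrightarrow> wsum (\<lambda>m'. has_colour n i m' \<and> m' > m) (raise m Y) =
      wsum (\<lambda>m'. has_colour n i m' \<and> m' > m) Y"
    and "wt Y m = 1 \<Longrightarrow> wsum (\<lambda>m'. has_colour n i m' \<and> m' < m) (lower m Y) =
      wsum (\<lambda>m'. has_colour n i m' \<and> m' < m) Y"
  using same_colour_not_adjacent[OF assms(1,2,4)]
  by (simp_all add: wsum_raise[OF assms(3)] wsum_lower[OF assms(3)])

text \<open>\<open>L\<close> may contain levels without a corner, whose terms are 0. This freedom
  allows several diagrams to share one index set.\<close>

lemma E_op_basis:
  assumes "n \<ge> 2" "i \<le> n" "Y \<in> diagrams k" "finite L"
    and "\<And>m. wt Y m \<noteq> 0 \<Longrightarrow> has_colour n i m \<Longrightarrow> m \<in> L" "\<And>m. m \<in> L \<Longrightarrow> has_colour n i m"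
  shows "E_op n i (basis Y) = (\<Sum>m\<in>L. e_term n i m Y)"
proof -
  let ?S = "{s. convex_corner Y s \<and> has_colour n i (level s)}"
  let ?g = "\<lambda>s. if s \<in> sites n i
     then T_prod n 1 {s' \<in> sites n i. level s' > level s} (E_site s Y) else 0"
  have bij: "bij_betw level ?S {m. wt Y m = -1 \<and> has_colour n i m}"
    by (rule bij_betw_Collect_restrict[OF bij_convex[OF assms(3)]])
  moreover have "finite {m. wt Y m = -1 \<and> has_colour n i m}"
    by (rule finite_subset[OF _ finite_wt[OF assms(3)]]) auto
  ultimately have "finite ?S" by (metis bij_betw_finite)
  have "?g s = e_term n i (level s) Y" if "s \<in> ?S" for s
  proof -
    note corner = convex_corner_level[OF assms(3), of s]
    have "T_prod n 1 {s' \<in> sites n i. level s' > level s} (basis (raise (level s) Y)) =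
        Poly_Mapping.single (raise (level s) Y)
          (q_sub n i powi wsum (\<lambda>m'. has_colour n i m' \<and> m' > level s) Y)"
      using that corner(1)
      by (simp add: T_prod_single[OF assms(1,2) raise_closed[OF assms(3)],
            where P = "\<lambda>m. m > level s"]
          wsum_beyond_move[OF assms(1-3)])
    then show ?thesis
      using that corner(1,2) by (simp add: sites_def E_site_def e_term_def)
  qed
  moreover have "{s. ?g s \<noteq> 0} \<subseteq> ?S"
    by (auto simp: E_site_def T_prod_def sites_def fock_linear_simps fock_linear_diag_op)
  ultimately have "E_op n i (basis Y) = (\<Sum>s\<in>?S. e_term n i (level s) Y)"
    using \<open>finite ?S\<close> by (simp add: E_op_def Sum_any.expand_superset)
  also have "\<dots> = (\<Sum>m | wt Y m = -1 \<and> has_colour n i m. e_term n i m Y)"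
    by (rule sum.reindex_bij_betw[OF bij])
  also have "\<dots> = (\<Sum>m\<in>L. e_term n i m Y)"
    using assms(4-6) by (intro sum.mono_neutral_left) (auto simp: e_term_def)
  finally show ?thesis .
qed

lemma F_op_basis:
  assumes "n \<ge> 2" "i \<le> n" "Y \<in> diagrams k" "finite L"
    and "\<And>m. wt Y m \<noteq> 0 \<Longrightarrow> has_colour n i m \<Longrightarrow> m \<in> L" "\<And>m. m \<in> L \<Longrightarrow> has_colour n i m"
  shows "F_op n i (basis Y) = (\<Sum>m\<in>L. f_term n i m Y)"
proof -
  let ?S = "{s. concave Y s \<and> has_colour n i (level s)}"
  let ?g = "\<lambda>s. if s \<in> sites n i
     then T_prod n (-1) {s' \<in> sites n i. level s' < level s} (F_site s Y) else 0"
  have bij: "bij_betw level ?S {m. wt Y m = 1 \<and> has_colour n i m}"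
    by (rule bij_betw_Collect_restrict[OF bij_concave[OF assms(3)]])
  moreover have "finite {m. wt Y m = 1 \<and> has_colour n i m}"
    by (rule finite_subset[OF _ finite_wt[OF assms(3)]]) auto
  ultimately have "finite ?S" by (metis bij_betw_finite)
  have "?g s = f_term n i (level s) Y" if "s \<in> ?S" for s
  proof -
    note corner = concave_level[OF assms(3), of s]
    have "T_prod n (-1) {s' \<in> sites n i. level s' < level s} (basis (lower (level s) Y)) =
        Poly_Mapping.single (lower (level s) Y)
          (q_sub n i powi (- wsum (\<lambda>m'. has_colour n i m' \<and> m' < level s) Y))"
      using that corner(1)
      by (simp add: T_prod_single[OF assms(1,2) lower_closed[OF assms(3)],
            where P = "\<lambda>m. m < level s"]
          wsum_beyond_move[OF assms(1-3)])
    then show ?thesis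
      using that corner(1,2) by (simp add: sites_def F_site_def f_term_def)
  qed
  moreover have "{s. ?g s \<noteq> 0} \<subseteq> ?S"
    by (auto simp: F_site_def T_prod_def sites_def fock_linear_simps fock_linear_diag_op)
  ultimately have "F_op n i (basis Y) = (\<Sum>s\<in>?S. f_term n i (level s) Y)"
    using \<open>finite ?S\<close> by (simp add: F_op_def Sum_any.expand_superset)
  also have "\<dots> = (\<Sum>m | wt Y m = 1 \<and> has_colour n i m. f_term n i m Y)"
    by (rule sum.reindex_bij_betw[OF bij])
  also have "\<dots> = (\<Sum>m\<in>L. f_term n i m Y)"
    using assms(4-6) by (intro sum.mono_neutral_left) (auto simp: f_term_def)
  finally show ?thesis .
qed

lemma fock_linear_ops: "fock_linear (E_op n i)" "fock_linear (F_op n i)"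
  by (simp_all add: E_op_def F_op_def fock_linear_linear_ext)

lemma cc_minus_cx:
  assumes "Y \<in> diagrams k"
  shows "int (cc n i Y) - int (cx n i Y) = wsum (has_colour n i) Y"
proof -
  let ?A = "{m. wt Y m = 1 \<and> has_colour n i m}" and ?B = "{m. wt Y m = -1 \<and> has_colour n i m}"
  have fin: "finite ?A" "finite ?B"
    by (rule finite_subset[OF _ finite_wt[OF assms]], auto)+
  have "cc n i Y = card ?A" "cx n i Y = card ?B"
    unfolding cc_def cx_def
    using bij_betw_same_card[OF bij_betw_Collect_restrict[OF bij_concave[OF assms]], of "has_colour n i"]
      bij_betw_same_card[OF bij_betw_Collect_restrict[OF bij_convex[OF assms]], of "has_colour n i"]
    by simp_all
  moreover have "{m. wt Y m \<noteq> 0 \<and> has_colour n i m} = ?A \<union> ?B"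
    using wt_eq_iff(3) by blast
  then have "wsum (has_colour n i) Y = (\<Sum>m\<in>?A. wt Y m) + (\<Sum>m\<in>?B. wt Y m)"
    unfolding wsum_def by (simp add: sum.union_disjoint[OF fin] disjoint_iff)
  ultimately show ?thesis by simp
qed

lemma finite_boxes:
  assumes "Y \<in> diagrams k"
  shows "finite (boxes k Y)"
proof -
  obtain N where N: "\<And>l. l \<ge> N \<Longrightarrow> Y l = int k"
    using assms by (auto simp: diagrams_def eventually_sequentially)
  have "boxes k Y \<subseteq> {..N} \<times> {Y 0..int k}"
  proof
    fix b assume "b \<in> boxes k Y"
    then obtain l y where b: "b = (l, y)" "Y l < y" "y \<le> int k" by (auto simp: boxes_def)
    then have "l < N" using N[of l] by (cases "l < N") auto
    then show "b \<in> {..N} \<times> {Y 0..int k}"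
      using b diagram_mono[OF assms, of 0 l] by simp
  qed
  then show ?thesis by (rule finite_subset) simp
qed

text \<open>The removed box (l, y_l + 1) has level m, the same as the corner, so
  \<open>Td_op\<close> registers exactly the moves of colour 0.\<close>

lemma card_boxes_raise:
  assumes "Y \<in> diagrams k" "wt Y m = -1"
  shows "int (card {b \<in> boxes k (raise m Y). has_colour n 0 (level b)}) =
    int (card {b \<in> boxes k Y. has_colour n 0 (level b)}) - of_bool (has_colour n 0 m)"
proof -
  obtain l where l: "int l + Y l = m - 1" "Y l < Y (Suc l)"
    using assms by (rule wt_minus_oneE)
  obtain N where N: "\<And>l. l \<ge> N \<Longrightarrow> Y l = int k"
    using assms by (auto simp: diagrams_def eventually_sequentially)
  have "Y (Suc l) \<le> int k"
    using diagram_mono[OF assms(1), of "Suc l" "max N (Suc l)"] N[of "max N (Suc l)"] by simp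
  with l(2) have Yl: "Y l + 1 \<le> int k" by simp
  define b where "b = (l, Y l + 1)"
  define B where "B = {b \<in> boxes k (raise m Y). has_colour n 0 (level b)}"
  have "boxes k Y = insert b (boxes k (raise m Y))" "b \<notin> boxes k (raise m Y)"
    using Yl by (auto simp: raise_eq[OF assms(1) l(1)] boxes_def b_def split: if_splits)
  moreover have "level b = m" using l(1) by (simp add: level_def b_def)
  ultimately have "{b \<in> boxes k Y. has_colour n 0 (level b)} =
      (if has_colour n 0 m then insert b B else B)" "b \<notin> B"
    by (auto simp: B_def)
  moreover have "finite B"
    using finite_boxes[OF raise_closed[OF assms]] by (simp add: B_def)
  ultimately show ?thesis unfolding B_def[symmetric] by simp
qed

section \<open>The relations of weight and commutator type\<close>

text \<open>The value on h of the weight of \<open>Y\<close>, that is, Lambda_k minus one simple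
  root alpha_i for each box of colour i, normalised to be 0 on d for the empty diagram.\<close>

definition pairing :: "nat \<Rightarrow> nat \<Rightarrow> (cobasis \<Rightarrow>\<^sub>0 int) \<Rightarrow> diagram \<Rightarrow> int" where
  "pairing n k h Y = (\<Sum>i\<le>n. Poly_Mapping.lookup h (H i) * wsum (has_colour n i) Y) -
     Poly_Mapping.lookup h D * int (card {b \<in> boxes k Y. has_colour n 0 (level b)})"

definition gen_op :: "nat \<Rightarrow> nat \<Rightarrow> gen \<Rightarrow> fock \<Rightarrow> fock" where
  "gen_op n k a = (case a of Gen_e i \<Rightarrow> E_op n i | Gen_f i \<Rightarrow> F_op n i
     | Gen_q h \<Rightarrow> diag_op (\<lambda>Y. qvar powi pairing n k h Y))"

lemma gen_op_simps [simp]: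
  "gen_op n k (Gen_e i) = E_op n i" "gen_op n k (Gen_f i) = F_op n i"
  "gen_op n k (Gen_q h) = diag_op (\<lambda>Y. qvar powi pairing n k h Y)"
  by (simp_all add: gen_op_def)

lemma fock_linear_gen_op: "fock_linear (gen_op n k a)"
  by (cases a) (simp_all add: fock_linear_ops fock_linear_diag_op)

lemma pairing_simps [simp]:
  "pairing n k 0 Y = 0"
  "pairing n k (h + h') Y = pairing n k h Y + pairing n k h' Y"
  "pairing n k (- h) Y = - pairing n k h Y"
  by (simp_all add: pairing_def lookup_add algebra_simps sum.distrib sum_negf)

lemma pairing_single_H:
  "i \<le> n \<Longrightarrow> pairing n k (Poly_Mapping.single (H i) c) Y = c * wsum (has_colour n i) Y"
  by (simp add: pairing_def lookup_single when_def if_distrib[of "\<lambda>x. x * _"] cong: if_cong)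

lemma pairing_single_D:
  "pairing n k (Poly_Mapping.single D c) Y =
    - c * int (card {b \<in> boxes k Y. has_colour n 0 (level b)})"
  by (simp add: pairing_def lookup_single when_def)

lemma simple_root_single_H:
  "j \<le> n \<Longrightarrow> simple_root n i (Poly_Mapping.single (H j) c) = cartan n j i * c"
  by (simp add: simple_root_def lookup_single when_def if_distrib[of "\<lambda>x. _ * x"] cong: if_cong)

lemma simple_root_uminus: "simple_root n i (- h) = - simple_root n i h"
  by (simp add: simple_root_def sum_negf)

text \<open>Removing a box of colour i adds alpha_i to the weight. The h_j-part is the folded second
  difference, the d-part the loss of a box of colour 0.\<close>

lemma pairing_raise:
  assumes "n \<ge> 2" "i \<le> n" "Y \<in> diagrams k" "wt Y m = -1" "has_colour n i m"
  shows "pairing n k h (raise m Y) = pairing n k h Y + simple_root n i h"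
proof -
  have "has_colour n 0 m \<longleftrightarrow> i = 0"
    using has_colour_unique[OF assms(1), of 0 i m] assms(2,5) by auto
  moreover have "wsum (has_colour n j) (raise m Y) = wsum (has_colour n j) Y + cartan n j i"
    if "j \<le> n" for j
    using cartan_eq_sum_levels[OF assms(1) that assms(2,5)] by (simp add: wsum_raise[OF assms(3,4)])
  ultimately show ?thesis
    by (simp add: pairing_def simple_root_def card_boxes_raise[OF assms(3,4)] algebra_simps sum.distrib)
qed

lemma pairing_lower:
  assumes "n \<ge> 2" "i \<le> n" "Y \<in> diagrams k" "wt Y m = 1" "has_colour n i m"
  shows "pairing n k h (lower m Y) = pairing n k h Y - simple_root n i h"
proof -
  have "wt (lower m Y) m = -1" using assms(4) by (simp add: wt_lower[OF assms(3,4)])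
  from pairing_raise[OF assms(1,2) lower_closed[OF assms(3,4)] this assms(5), of h] show ?thesis
    by (simp add: raise_lower[OF assms(3,4)])
qed

definition corners :: "nat \<Rightarrow> nat \<Rightarrow> diagram \<Rightarrow> int set" where
  "corners n i Y = {m. wt Y m \<noteq> 0 \<and> has_colour n i m}"

lemma finite_corners: "Y \<in> diagrams k \<Longrightarrow> finite (corners n i Y)"
  unfolding corners_def by (rule finite_subset[OF _ finite_wt]) auto

lemma op_basis_corners:
  assumes "n \<ge> 2" "i \<le> n" "Y \<in> diagrams k"
  shows "E_op n i (basis Y) = (\<Sum>m\<in>corners n i Y. e_term n i m Y)"
    and "F_op n i (basis Y) = (\<Sum>m\<in>corners n i Y. f_term n i m Y)"
  by (rule E_op_basis[OF assms finite_corners[OF assms(3)]]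
      F_op_basis[OF assms finite_corners[OF assms(3)]]; simp add: corners_def)+

lemma diag_op_term:
  "diag_op c (e_term n i m Y) = fock_scale (c (raise m Y)) (e_term n i m Y)"
  "diag_op c (f_term n i m Y) = fock_scale (c (lower m Y)) (f_term n i m Y)"
  by (simp_all add: e_term_def f_term_def fock_scale_single fock_linear_simps fock_linear_diag_op)

lemma qh_E_basis:
  assumes "n \<ge> 2" "i \<le> n" "Y \<in> diagrams k"
  shows "gen_op n k (Gen_q h) (E_op n i (basis Y)) =
    fock_scale (qvar powi simple_root n i h) (E_op n i (gen_op n k (Gen_q h) (basis Y)))"
proof -
  let ?c = "qvar powi simple_root n i h" and ?d = "qvar powi pairing n k h Y"
  have "fock_scale (qvar powi pairing n k h (raise m Y)) (e_term n i m Y) =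
      fock_scale (?c * ?d) (e_term n i m Y)" if "m \<in> corners n i Y" for m
    using that pairing_raise[OF assms, of m h]
    by (cases "wt Y m = -1")
      (simp_all add: corners_def e_term_def power_int_add qvar_nonzero mult.commute)
  then have "gen_op n k (Gen_q h) (E_op n i (basis Y)) = fock_scale (?c * ?d) (E_op n i (basis Y))"
    by (simp add: op_basis_corners[OF assms] fock_linear_simps fock_linear_diag_op diag_op_term
        fock.scale_sum_right)
  also have "\<dots> = fock_scale ?c (E_op n i (fock_scale ?d (basis Y)))"
    by (simp add: fock_linear_simps fock_linear_ops)
  finally show ?thesis by (simp add: fock_scale_single)
qed

lemma qh_F_basis:
  assumes "n \<ge> 2" "i \<le> n" "Y \<in> diagrams k"
  shows "gen_op n k (Gen_q h) (F_op n i (basis Y)) =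
    fock_scale (qvar powi (- simple_root n i h)) (F_op n i (gen_op n k (Gen_q h) (basis Y)))"
proof -
  let ?c = "qvar powi (- simple_root n i h)" and ?d = "qvar powi pairing n k h Y"
  have "qvar powi pairing n k h (lower m Y) = ?c * ?d" if "wt Y m = 1" "has_colour n i m" for m
    unfolding power_int_add[OF disjI1[OF qvar_nonzero], symmetric] pairing_lower[OF assms that]
    by simp
  then have "fock_scale (qvar powi pairing n k h (lower m Y)) (f_term n i m Y) =
      fock_scale (?c * ?d) (f_term n i m Y)" if "m \<in> corners n i Y" for m
    using that by (cases "wt Y m = 1") (simp_all add: corners_def f_term_def)
  then have "gen_op n k (Gen_q h) (F_op n i (basis Y)) = fock_scale (?c * ?d) (F_op n i (basis Y))"
    by (simp add: op_basis_corners[OF assms] fock_linear_simps fock_linear_diag_op diag_op_term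
        fock.scale_sum_right)
  also have "\<dots> = fock_scale ?c (F_op n i (fock_scale ?d (basis Y)))"
    by (simp add: fock_linear_simps fock_linear_ops)
  finally show ?thesis by (simp add: fock_scale_single)
qed

section \<open>Commutators of e_i and f_j\<close>

lemma wt_abs_le: "\<bar>wt Y m\<bar> \<le> 1"
  by (simp add: wt_def of_bool_def)

text \<open>At this distance the pairs of positions m - 1, m and m' - 1, m' are disjoint.\<close>

lemma raise_lower_commute:
  assumes "Y \<in> diagrams k" "wt Y m = -1" "wt Y m' = 1" "\<bar>m - m'\<bar> \<ge> 2"
  shows "raise m (lower m' Y) = lower m' (raise m Y)"
proof (rule occ_eqD)
  have wt: "wt (lower m' Y) m = -1" "wt (raise m Y) m' = 1"
    using assms(2-4) by (auto simp: wt_lower[OF assms(1,3)] wt_raise[OF assms(1,2)])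
  show "raise m (lower m' Y) \<in> diagrams k" "lower m' (raise m Y) \<in> diagrams k"
    using wt assms by (simp_all add: raise_closed[where k = k] lower_closed[where k = k])
  show "occ (raise m (lower m' Y)) = occ (lower m' (raise m Y))"
    unfolding occ_raise[OF lower_closed[OF assms(1,3)] wt(1)] occ_lower[OF assms(1,3)]
      occ_lower[OF raise_closed[OF assms(1,2)] wt(2)] occ_raise[OF assms(1,2)]
    using assms(4) by auto
qed

lemma ef_terms_commute:
  assumes "n \<ge> 2" "i \<le> n" "j \<le> n" "Y \<in> diagrams k"
    and "has_colour n i m" "has_colour n j m'" "m \<noteq> m'"
  shows "linear_ext (e_term n i m) (f_term n j m' Y) = linear_ext (f_term n j m') (e_term n i m Y)"
proof (cases "wt Y m = -1 \<and> wt Y m' = 1 \<and> \<bar>m - m'\<bar> \<ge> 2")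
  case True
  then have wt: "wt Y m = -1" "wt Y m' = 1" and dist: "\<bar>m - m'\<bar> \<ge> 2" by auto
  have wt': "wt (lower m' Y) m = -1" "wt (raise m Y) m' = 1"
    using wt dist by (auto simp: wt_lower[OF assms(4) wt(2)] wt_raise[OF assms(4) wt(1)])
  let ?P = "\<lambda>t. has_colour n i t \<and> t > m" and ?Q = "\<lambda>t. has_colour n j t \<and> t < m'"
  let ?b = "of_bool (m < m') :: int"
  \<comment> \<open>The levels m' - 1, m', m' + 1 lie on one side of m, and m - 1, m, m + 1 on one
    side of m'. So each partial sum changes by a full Cartan entry if m < m', and not at all
    otherwise.\<close>
  have P: "wsum ?P (lower m' Y) = wsum ?P Y - ?b * cartan n i j"
    using dist unfolding cartan_eq_sum_levels[OF assms(1-3,6), symmetric]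
    by (cases "m < m'") (auto simp: wsum_lower[OF assms(4) wt(2)])
  have Q: "wsum ?Q (raise m Y) = wsum ?Q Y + ?b * cartan n j i"
    using dist unfolding cartan_eq_sum_levels[OF assms(1,3,2,5), symmetric]
    by (cases "m < m'") (auto simp: wsum_raise[OF assms(4) wt(1)])
  have "int (symm n i) * (?b * cartan n i j) = int (symm n j) * (?b * cartan n j i)"
    using symm_cartan[OF assms(1-3)] by (metis mult.left_commute)
  then have "int (symm n i) * wsum ?P (lower m' Y) + int (symm n j) * - wsum ?Q Y =
      int (symm n i) * wsum ?P Y + int (symm n j) * - wsum ?Q (raise m Y)"
    unfolding P Q right_diff_distrib distrib_left minus_add_distrib by linarith
  then have "q_sub n i powi wsum ?P (lower m' Y) * q_sub n j powi (- wsum ?Q Y) =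
      q_sub n i powi wsum ?P Y * q_sub n j powi (- wsum ?Q (raise m Y))"
    unfolding q_sub_powi power_int_add[OF disjI1[OF qvar_nonzero], symmetric] by (rule arg_cong)
  then show ?thesis
    using wt wt' raise_lower_commute[OF assms(4) wt dist]
    by (simp add: e_term_def f_term_def linear_ext_single fock_scale_single mult.commute)
next
  case False
  \<comment> \<open>Between adjacent levels the moves block each other: lowering at m' adds 1 to
    \<open>wt\<close> at m, and raising at m subtracts 1 from \<open>wt\<close> at m', so the second
    move finds no suitable corner.\<close>
  have "linear_ext (e_term n i m) (f_term n j m' Y) = 0"
  proof (cases "wt Y m' = 1")
    case True
    have "wt (lower m' Y) m \<noteq> -1"
      using False True assms(7) wt_abs_le[of Y m] by (auto simp: wt_lower[OF assms(4) True])
    then show ?thesis using True by (simp add: e_term_def f_term_def linear_ext_single)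
  qed (simp add: f_term_def fock_linear_simps fock_linear_linear_ext)
  moreover have "linear_ext (f_term n j m') (e_term n i m Y) = 0"
  proof (cases "wt Y m = -1")
    case True
    have "wt (raise m Y) m' \<noteq> 1"
      using False True assms(7) wt_abs_le[of Y m'] by (auto simp: wt_raise[OF assms(4) True])
    then show ?thesis using True by (simp add: e_term_def f_term_def linear_ext_single)
  qed (simp add: e_term_def fock_linear_simps fock_linear_linear_ext)
  ultimately show ?thesis by simp
qed

text \<open>The contribution of one tensor factor: level m gives the q-integer of
  \<open>wt Y m\<close>, the levels above enter through k_i and those below through its inverse.
  Moving at m leaves these sums alone, since its neighbours have other colours.\<close>

lemma ef_term_same:
  assumes "n \<ge> 2" "i \<le> n" "Y \<in> diagrams k" "has_colour n i m"
  shows "linear_ext (e_term n i m) (f_term n i m Y) - linear_ext (f_term n i m) (e_term n i m Y) =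
    Poly_Mapping.single Y (1 / (q_sub n i - inverse (q_sub n i)) *
      ((q_sub n i powi wt Y m - q_sub n i powi (- wt Y m)) *
       q_sub n i powi (wsum (\<lambda>m'. has_colour n i m' \<and> m' > m) Y -
         wsum (\<lambda>m'. has_colour n i m' \<and> m' < m) Y)))"
proof -
  note nonadj = same_colour_not_adjacent[OF assms(1,2,4)]
  let ?P = "\<lambda>m'. has_colour n i m' \<and> m' > m" and ?Q = "\<lambda>m'. has_colour n i m' \<and> m' < m"
  let ?x = "q_sub n i"
  note nz = q_sub_diff_nonzero[of n i] q_sub_nonzero[of n i]
  have split: "?x powi wsum ?P Y * ?x powi (- wsum ?Q Y) = ?x powi (wsum ?P Y - wsum ?Q Y)"
    using nz(2) by (simp flip: power_int_add)
  have cancel: "1 / (?x - inverse ?x) * ((?x - inverse ?x) * c) = c" for c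
    using nz(1) by simp
  note terms = e_term_def f_term_def linear_ext_single fock_scale_single fock_linear_simps
    fock_linear_linear_ext
  consider "wt Y m = 1" | "wt Y m = -1" | "wt Y m = 0" using wt_eq_iff(3) by blast
  then show ?thesis
  proof cases
    case 1
    have "wt (lower m Y) m = -1" using 1 by (simp add: wt_lower[OF assms(3) 1])
    moreover have "wsum ?P (lower m Y) = wsum ?P Y"
      using nonadj by (simp add: wsum_lower[OF assms(3) 1])
    ultimately have "linear_ext (e_term n i m) (f_term n i m Y) =
        Poly_Mapping.single Y (?x powi (wsum ?P Y - wsum ?Q Y))"
      using 1 by (simp add: terms raise_lower[OF assms(3)] mult.commute flip: split)
    moreover have "linear_ext (f_term n i m) (e_term n i m Y) = 0" using 1 by (simp add: terms)
    ultimately show ?thesis using 1 cancel by simp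
  next
    case 2
    have "wt (raise m Y) m = 1" using 2 by (simp add: wt_raise[OF assms(3) 2])
    moreover have "wsum ?Q (raise m Y) = wsum ?Q Y"
      using nonadj by (simp add: wsum_raise[OF assms(3) 2])
    ultimately have "linear_ext (f_term n i m) (e_term n i m Y) =
        Poly_Mapping.single Y (?x powi (wsum ?P Y - wsum ?Q Y))"
      using 2 by (simp add: terms lower_raise[OF assms(3)] flip: split)
    moreover have "linear_ext (e_term n i m) (f_term n i m Y) = 0" using 2 by (simp add: terms)
    moreover have "(?x powi (- 1) - ?x powi (- (- 1))) * c = (?x - inverse ?x) * - c" for c
      by (simp add: algebra_simps)
    ultimately show ?thesis using 2 by (simp only: cancel diff_0 single_uminus)
  next
    case 3
    then show ?thesis by (simp add: terms)
  qed
qed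

text \<open>The expansion of k - k^(-1) over an ordered tensor product. Splitting off the largest
  level b multiplies the sum over L by x^(w b) and adds a term carrying the inverse of x^(sum w L);
  the mixed terms cancel.\<close>

lemma telescope_powi:
  fixes x :: "'a :: field" and w :: "int \<Rightarrow> int"
  assumes "finite L" "x \<noteq> 0"
  shows "(\<Sum>m\<in>L. (x powi w m - x powi (- w m)) *
      x powi (sum w {m' \<in> L. m' > m} - sum w {m' \<in> L. m' < m})) =
    x powi sum w L - x powi (- sum w L)"
  using assms(1)
proof (induction L rule: finite_linorder_max_induct)
  case (insert b L)
  have up: "sum w {m' \<in> insert b L. m' > m} = w b + sum w {m' \<in> L. m' > m}"
    and down: "{m' \<in> insert b L. m' < m} = {m' \<in> L. m' < m}" if "m \<in> L" for m
  proof -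
    have "{m' \<in> insert b L. m' > m} = insert b {m' \<in> L. m' > m}"
      using insert.hyps that by auto
    then show "sum w {m' \<in> insert b L. m' > m} = w b + sum w {m' \<in> L. m' > m}"
      using insert.hyps by auto
    show "{m' \<in> insert b L. m' < m} = {m' \<in> L. m' < m}"
      using insert.hyps that by auto
  qed
  have top: "{m' \<in> insert b L. m' > b} = {}" "{m' \<in> insert b L. m' < b} = L"
    using insert.hyps by auto
  have notin: "b \<notin> L" using insert.hyps by auto
  let ?g = "\<lambda>m. (x powi w m - x powi (- w m)) *
      x powi (sum w {m' \<in> insert b L. m' > m} - sum w {m' \<in> insert b L. m' < m})"
  have "sum ?g (insert b L) = ?g b + sum ?g L"
    by (rule sum.insert[OF insert.hyps(1) notin])
  also have "?g b = (x powi w b - x powi (- w b)) * x powi (- sum w L)"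
    by (simp only: top sum.empty diff_0)
  also have "sum ?g L = (\<Sum>m\<in>L. (x powi w m - x powi (- w m)) *
      x powi (w b + (sum w {m' \<in> L. m' > m} - sum w {m' \<in> L. m' < m})))"
    by (rule sum.cong) (simp_all only: up down add_diff_eq)
  also have "(\<Sum>m\<in>L. (x powi w m - x powi (- w m)) *
      x powi (w b + (sum w {m' \<in> L. m' > m} - sum w {m' \<in> L. m' < m}))) =
    x powi w b * (x powi sum w L - x powi (- sum w L))"
    unfolding insert.IH[symmetric] sum_distrib_left
    by (rule sum.cong) (simp_all add: power_int_add assms(2) mult_ac)
  also have "(x powi w b - x powi (- w b)) * x powi (- sum w L) +
      x powi w b * (x powi sum w L - x powi (- sum w L)) =
    x powi (w b + sum w L) - x powi (- (w b + sum w L))"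
    using assms(2) by (simp add: power_int_add power_int_diff power_int_minus algebra_simps)
      (simp add: field_simps)
  finally show ?case by (simp only: sum.insert[OF insert.hyps(1) notin])
qed simp

lemma wsum_filter:
  assumes "finite L" "\<And>m. m \<in> L \<Longrightarrow> P m" "\<And>m. wt Y m \<noteq> 0 \<Longrightarrow> P m \<Longrightarrow> m \<in> L"
  shows "wsum (\<lambda>m. P m \<and> R m) Y = sum (wt Y) {m \<in> L. R m}"
  unfolding wsum_def using assms by (intro sum.mono_neutral_left) auto

lemma ef_commutator_basis:
  assumes "n \<ge> 2" "i \<le> n" "j \<le> n" "Y \<in> diagrams k"
  shows "E_op n i (F_op n j (basis Y)) - F_op n j (E_op n i (basis Y)) =
    (if i = j then Poly_Mapping.single Y (1 / (q_sub n i - inverse (q_sub n i)) *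
       (q_sub n i powi wsum (has_colour n i) Y - q_sub n i powi (- wsum (has_colour n i) Y)))
     else 0)"
proof -
  \<comment> \<open>Corner levels with their neighbours: a move changes corners only within distance
    one of its level, so the same finite set serves \<open>Y\<close> and every diagram one move
    away.\<close>
  define N where "N = (\<Union>m\<in>{m. wt Y m \<noteq> 0}. {m - 1, m, m + 1})"
  define L where "L i = {m \<in> N. has_colour n i m}" for i
  have finite: "finite (L i)" for i
    using finite_wt[OF assms(4)] by (simp add: L_def N_def)
  have L_colour: "has_colour n i m" if "m \<in> L i" for i m
    using that by (simp add: L_def)
  have L_super: "m \<in> L i" if "wt Y m \<noteq> 0" "has_colour n i m" for m i
    using that by (auto simp: L_def N_def)
  have L_lower: "m \<in> L i" if "wt Y m' = 1" "wt (lower m' Y) m \<noteq> 0" "has_colour n i m" for m m' i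
  proof -
    have "wt Y m \<noteq> 0 \<or> m \<in> {m' - 1, m', m' + 1}"
      using that(2) by (auto simp: wt_lower[OF assms(4) that(1)] split: if_splits)
    then show ?thesis using that by (force simp: L_def N_def)
  qed
  have L_raise: "m \<in> L i" if "wt Y m' = -1" "wt (raise m' Y) m \<noteq> 0" "has_colour n i m" for m m' i
  proof -
    have "wt Y m \<noteq> 0 \<or> m \<in> {m' - 1, m', m' + 1}"
      using that(2) by (auto simp: wt_raise[OF assms(4) that(1)] split: if_splits)
    then show ?thesis using that by (force simp: L_def N_def)
  qed
  have E_f: "E_op n i (f_term n j m' Y) = (\<Sum>m\<in>L i. linear_ext (e_term n i m) (f_term n j m' Y))" for m'
  proof (cases "wt Y m' = 1")
    case True
    have "E_op n i (basis (lower m' Y)) = (\<Sum>m\<in>L i. e_term n i m (lower m' Y))"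
      using L_lower[OF True] L_colour
      by (intro E_op_basis[OF assms(1,2) lower_closed[OF assms(4) True] finite]) auto
    then have "E_op n i (fock_scale c (basis (lower m' Y))) =
        (\<Sum>m\<in>L i. linear_ext (e_term n i m) (fock_scale c (basis (lower m' Y))))" for c
      by (simp add: fock_linear_simps fock_linear_ops fock_linear_linear_ext fock.scale_sum_right)
    then show ?thesis using True by (simp add: f_term_def fock_scale_single)
  qed (simp add: f_term_def fock_linear_simps fock_linear_ops fock_linear_linear_ext)
  have F_e: "F_op n j (e_term n i m Y) = (\<Sum>m'\<in>L j. linear_ext (f_term n j m') (e_term n i m Y))" for m
  proof (cases "wt Y m = -1")
    case True
    have "F_op n j (basis (raise m Y)) = (\<Sum>m'\<in>L j. f_term n j m' (raise m Y))"
      using L_raise[OF True] L_colour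
      by (intro F_op_basis[OF assms(1,3) raise_closed[OF assms(4) True] finite]) auto
    then have "F_op n j (fock_scale c (basis (raise m Y))) =
        (\<Sum>m'\<in>L j. linear_ext (f_term n j m') (fock_scale c (basis (raise m Y))))" for c
      by (simp add: fock_linear_simps fock_linear_ops fock_linear_linear_ext fock.scale_sum_right)
    then show ?thesis using True by (simp add: e_term_def fock_scale_single)
  qed (simp add: e_term_def fock_linear_simps fock_linear_ops fock_linear_linear_ext)
  define C where "C m m' = linear_ext (e_term n i m) (f_term n j m' Y) -
    linear_ext (f_term n j m') (e_term n i m Y)" for m m'
  have "E_op n i (F_op n j (basis Y)) = (\<Sum>m'\<in>L j. \<Sum>m\<in>L i. linear_ext (e_term n i m) (f_term n j m' Y))"
    using F_op_basis[OF assms(1,3,4) finite L_super L_colour]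
    by (simp add: fock_linear_simps fock_linear_ops E_f)
  also have "\<dots> = (\<Sum>m\<in>L i. \<Sum>m'\<in>L j. linear_ext (e_term n i m) (f_term n j m' Y))"
    by (rule sum.swap)
  finally have EF: "E_op n i (F_op n j (basis Y)) - F_op n j (E_op n i (basis Y)) =
      (\<Sum>m\<in>L i. \<Sum>m'\<in>L j. C m m')"
    using E_op_basis[OF assms(1,2,4) finite L_super L_colour]
    by (simp add: fock_linear_simps fock_linear_ops F_e C_def sum_subtractf)
  \<comment> \<open>Only diagonal terms survive. For i different from j there are none, because a
    level has only one colour.\<close>
  have C_zero: "C m m' = 0" if "m \<in> L i" "m' \<in> L j" "m \<noteq> m'" for m m'
    unfolding C_def using ef_terms_commute[OF assms, of m m'] that L_colour by simp
  show ?thesis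
  proof (cases "i = j")
    case False
    then have "m \<noteq> m'" if "m \<in> L i" "m' \<in> L j" for m m'
      using that L_colour has_colour_unique[OF assms(1-3)] by blast
    then show ?thesis using False C_zero EF by simp
  next
    case True
    let ?x = "q_sub n i" and ?W = "wsum (has_colour n i) Y"
    have "(\<Sum>m'\<in>L j. C m m') = Poly_Mapping.single Y (1 / (?x - inverse ?x) *
        ((?x powi wt Y m - ?x powi (- wt Y m)) *
         ?x powi (sum (wt Y) {m' \<in> L i. m' > m} - sum (wt Y) {m' \<in> L i. m' < m})))"
      if "m \<in> L i" for m
    proof -
      have "(\<Sum>m'\<in>L j. C m m') = (\<Sum>m'\<in>{m}. C m m')"
        using that True finite C_zero by (intro sum.mono_neutral_right) auto
      then show ?thesis
        using ef_term_same[OF assms(1,2,4) L_colour[OF that]] True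
        by (simp add: C_def wsum_filter[OF finite L_colour L_super])
    qed
    then have "(\<Sum>m\<in>L i. \<Sum>m'\<in>L j. C m m') = Poly_Mapping.single Y (1 / (?x - inverse ?x) *
        (\<Sum>m\<in>L i. (?x powi wt Y m - ?x powi (- wt Y m)) *
         ?x powi (sum (wt Y) {m' \<in> L i. m' > m} - sum (wt Y) {m' \<in> L i. m' < m})))"
      by (auto intro!: poly_mapping_eqI simp: lookup_sum lookup_single when_def sum_distrib_left)
    also have "(\<Sum>m\<in>L i. (?x powi wt Y m - ?x powi (- wt Y m)) *
        ?x powi (sum (wt Y) {m' \<in> L i. m' > m} - sum (wt Y) {m' \<in> L i. m' < m})) =
        ?x powi sum (wt Y) (L i) - ?x powi (- sum (wt Y) (L i))"
      by (rule telescope_powi[OF finite q_sub_nonzero])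
    also have "sum (wt Y) (L i) = ?W"
    proof -
      have "wsum (\<lambda>m. has_colour n i m \<and> True) Y = sum (wt Y) {m \<in> L i. True}"
        by (rule wsum_filter[OF finite L_colour L_super])
      then show ?thesis by simp
    qed
    finally show ?thesis using True EF by simp
  qed
qed

section \<open>Local nilpotency and the Serre relations\<close>

text \<open>Linearity is spelled out as equations so that simplification proves it directly for
  composite operators.\<close>

lemma Fock_eqI:
  assumes "\<And>u v. f (u + v) = f u + f v" "\<And>c v. f (fock_scale c v) = fock_scale c (f v)"
    and "\<And>u v. g (u + v) = g u + g v" "\<And>c v. g (fock_scale c v) = fock_scale c (g v)"
    and "v \<in> carrier (Fock k)" "\<And>Y. Y \<in> diagrams k \<Longrightarrow> f (basis Y) = g (basis Y)"
  shows "f v = g v"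
  by (rule fock_linear_eqI[of f g v "diagrams k"])
    (use assms in \<open>auto intro!: fock_linearI simp: carrier_Fock\<close>)

lemmas linear_op_simps = fock_linear_simps fock_linear_ops fock_linear_gen_op fock_linear_diag_op
  fock.scale_right_distrib fock.scale_right_diff_distrib

text \<open>The sign treats both directions at once: -1 for \<open>raise\<close>, as in e_i, and 1
  for \<open>lower\<close>, as in f_i. Only the effect on \<open>wt\<close> is recorded, which
  suffices for counting corners.\<close>

definition corner_move :: "int \<Rightarrow> int \<Rightarrow> diagram \<Rightarrow> diagram \<Rightarrow> bool" where
  "corner_move \<sigma> m Y Z \<longleftrightarrow> wt Y m = \<sigma> \<and> (\<forall>m'. wt Z m' = wt Y m' -
     \<sigma> * (if m' = m then 2 else if m' = m - 1 \<or> m' = m + 1 then -1 else 0))"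

definition moves_corners :: "nat \<Rightarrow> nat \<Rightarrow> int \<Rightarrow> (nat \<Rightarrow> fock \<Rightarrow> fock) \<Rightarrow> bool" where
  "moves_corners n k \<sigma> A \<longleftrightarrow> (\<forall>j\<le>n. fock_linear (A j) \<and>
     (\<forall>Y\<in>diagrams k. \<forall>Z\<in>Poly_Mapping.keys (A j (basis Y)).
        Z \<in> diagrams k \<and> (\<exists>m. has_colour n j m \<and> corner_move \<sigma> m Y Z)))"

lemma moves_corners_E_op:
  assumes "n \<ge> 2"
  shows "moves_corners n k (-1) (E_op n)"
  unfolding moves_corners_def
proof (intro allI impI conjI ballI fock_linear_ops)
  fix j Y Z assume j: "j \<le> n" and Y: "Y \<in> diagrams k"
    and Z: "Z \<in> Poly_Mapping.keys (E_op n j (basis Y))"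
  have "Z \<in> (\<Union>m\<in>corners n j Y. Poly_Mapping.keys (e_term n j m Y))"
    using Z keys_sum[of "\<lambda>m. e_term n j m Y" "corners n j Y"]
    unfolding op_basis_corners(1)[OF assms j Y] by (rule subsetD[rotated])
  then obtain m where "m \<in> corners n j Y" "Z \<in> Poly_Mapping.keys (e_term n j m Y)" by (rule UN_E)
  then have m: "has_colour n j m" "wt Y m = -1" "Z = raise m Y"
    by (auto simp: corners_def e_term_def split: if_splits)
  show "Z \<in> diagrams k" using m raise_closed[OF Y] by simp
  show "\<exists>m. has_colour n j m \<and> corner_move (-1) m Y Z"
    unfolding corner_move_def m(3) wt_raise[OF Y m(2)] using m(1,2) by (intro exI[of _ m]) simp
qed

lemma moves_corners_F_op:
  assumes "n \<ge> 2"
  shows "moves_corners n k 1 (F_op n)"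
  unfolding moves_corners_def
proof (intro allI impI conjI ballI fock_linear_ops)
  fix j Y Z assume j: "j \<le> n" and Y: "Y \<in> diagrams k"
    and Z: "Z \<in> Poly_Mapping.keys (F_op n j (basis Y))"
  have "Z \<in> (\<Union>m\<in>corners n j Y. Poly_Mapping.keys (f_term n j m Y))"
    using Z keys_sum[of "\<lambda>m. f_term n j m Y" "corners n j Y"]
    unfolding op_basis_corners(2)[OF assms j Y] by (rule subsetD[rotated])
  then obtain m where "m \<in> corners n j Y" "Z \<in> Poly_Mapping.keys (f_term n j m Y)" by (rule UN_E)
  then have m: "has_colour n j m" "wt Y m = 1" "Z = lower m Y"
    by (auto simp: corners_def f_term_def split: if_splits)
  show "Z \<in> diagrams k" using m lower_closed[OF Y] by simp
  show "\<exists>m. has_colour n j m \<and> corner_move 1 m Y Z"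
    unfolding corner_move_def m(3) wt_lower[OF Y m(2)] using m(1,2) by (intro exI[of _ m]) simp
qed

definition few_corners :: "nat \<Rightarrow> nat \<Rightarrow> nat \<Rightarrow> nat \<Rightarrow> fock set" where
  "few_corners n k i p =
     {v. Poly_Mapping.keys v \<subseteq> {Y \<in> diagrams k. card (corners n i Y) \<le> p}}"

lemma few_corners_subset: "few_corners n k i p \<subseteq> carrier (Fock k)"
  by (auto simp: few_corners_def carrier_Fock)

lemma few_corners_keys:
  assumes "fock_linear f" "v \<in> few_corners n k i p"
    and "\<And>Y Z. Y \<in> diagrams k \<Longrightarrow> card (corners n i Y) \<le> p \<Longrightarrow>
      Z \<in> Poly_Mapping.keys (f (basis Y)) \<Longrightarrow> Z \<in> diagrams k \<and> card (corners n i Z) \<le> p'"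
  shows "f v \<in> few_corners n k i p'"
  using assms(2) keys_fock_linear[OF assms(1), of v "{Y \<in> diagrams k. card (corners n i Y) \<le> p}"
      "{Y \<in> diagrams k. card (corners n i Y) \<le> p'}"] assms(3)
  unfolding few_corners_def by blast

context
  fixes n k :: nat and \<sigma> :: int and A :: "nat \<Rightarrow> fock \<Rightarrow> fock"
  assumes n: "n \<ge> 2" and moves: "moves_corners n k \<sigma> A" and sign: "\<sigma> = 1 \<or> \<sigma> = -1"
begin

lemma moves_linear: "j \<le> n \<Longrightarrow> fock_linear (A j)"
  using moves by (simp add: moves_corners_def)

lemma moves_keys:
  assumes "j \<le> n" "Y \<in> diagrams k" "Z \<in> Poly_Mapping.keys (A j (basis Y))"
  obtains m where "Z \<in> diagrams k" "has_colour n j m" "corner_move \<sigma> m Y Z"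
  using moves assms unfolding moves_corners_def by blast

lemma moves_Fock: "j \<le> n \<Longrightarrow> v \<in> carrier (Fock k) \<Longrightarrow> A j v \<in> carrier (Fock k)"
  unfolding carrier_Fock
  by (rule keys_fock_linear[OF moves_linear], assumption+) (blast elim: moves_keys)

text \<open>Neighbours of m have other colours, so among the levels of colour i only m changes,
  where the sign of the corner is reversed.\<close>

lemma corner_move_same_colour:
  assumes "i \<le> n" "has_colour n i m" "corner_move \<sigma> m Y Z"
  shows "corners n i Z = corners n i Y"
    and "{t. wt Z t = \<sigma> \<and> has_colour n i t} = {t. wt Y t = \<sigma> \<and> has_colour n i t} - {m}"
proof -
  have m: "wt Y m = \<sigma>" using assms(3) by (simp add: corner_move_def)
  have wt: "wt Z t = (if t = m then - wt Y t else wt Y t)" if "has_colour n i t" for t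
  proof -
    have "t \<noteq> m - 1" "t \<noteq> m + 1"
      using same_colour_not_adjacent[OF n assms(1,2)] that by auto
    then show ?thesis using assms(3) m by (simp add: corner_move_def)
  qed
  show "corners n i Z = corners n i Y"
    by (auto simp: corners_def wt split: if_splits)
  show "{t. wt Z t = \<sigma> \<and> has_colour n i t} = {t. wt Y t = \<sigma> \<and> has_colour n i t} - {m}"
    using sign m by (auto simp: wt split: if_splits)
qed

lemma moves_few_corners_same:
  assumes "i \<le> n" "v \<in> few_corners n k i p"
  shows "A i v \<in> few_corners n k i p"
proof (rule few_corners_keys[OF moves_linear[OF assms(1)] assms(2)])
  fix Y Z assume Y: "Y \<in> diagrams k" "card (corners n i Y) \<le> p"
    and keys: "Z \<in> Poly_Mapping.keys (A i (basis Y))"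
  from assms(1) Y(1) keys obtain m where Z: "Z \<in> diagrams k" "has_colour n i m" "corner_move \<sigma> m Y Z"
    by (rule moves_keys)
  then show "Z \<in> diagrams k \<and> card (corners n i Z) \<le> p"
    using Y(2) corner_move_same_colour(1)[OF assms(1) Z(2,3)] by simp
qed

text \<open>Only the weights at m - 1, m and m + 1 change, which accounts for the 3.\<close>

lemma moves_few_corners_other:
  assumes "j \<le> n" "v \<in> few_corners n k i p"
  shows "A j v \<in> few_corners n k i (p + 3)"
proof (rule few_corners_keys[OF moves_linear[OF assms(1)] assms(2)])
  fix Y Z assume Y: "Y \<in> diagrams k" "card (corners n i Y) \<le> p"
    and keys: "Z \<in> Poly_Mapping.keys (A j (basis Y))"
  from assms(1) Y(1) keys obtain m where Z: "Z \<in> diagrams k" "corner_move \<sigma> m Y Z"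
    by (rule moves_keys)
  have "corners n i Z \<subseteq> corners n i Y \<union> {m - 1, m, m + 1}"
  proof
    fix t assume "t \<in> corners n i Z"
    moreover have "wt Z t = wt Y t" if "t \<notin> {m - 1, m, m + 1}"
      using Z(2) that by (simp add: corner_move_def)
    ultimately show "t \<in> corners n i Y \<union> {m - 1, m, m + 1}"
      by (cases "t \<in> {m - 1, m, m + 1}") (auto simp: corners_def)
  qed
  then have "card (corners n i Z) \<le> card (corners n i Y \<union> {m - 1, m, m + 1})"
    using finite_corners[OF Y(1)] by (intro card_mono) auto
  also have "\<dots> \<le> card (corners n i Y) + card {m - 1, m, m + 1}"
    by (rule card_Un_le)
  also have "\<dots> \<le> p + 3"
    using Y(2) by (intro add_mono) (simp_all add: card_insert_if)
  finally show "Z \<in> diagrams k \<and> card (corners n i Z) \<le> p + 3" using Z(1) by simp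
qed

text \<open>Each application uses up one corner of colour i with sign sigma and creates none, and at
  most p are available.\<close>

lemma moves_nilpotent:
  assumes "i \<le> n" "v \<in> few_corners n k i p" "r > p"
  shows "(A i ^^ r) v = 0"
proof -
  let ?N = "\<lambda>Y. card {t. wt Y t = \<sigma> \<and> has_colour n i t}"
  have fin: "finite {t. wt Y t = \<sigma> \<and> has_colour n i t}" if "Y \<in> diagrams k" for Y
    using sign by (intro finite_subset[OF _ finite_corners[OF that, of n i]]) (auto simp: corners_def)
  have zero: "(A i ^^ r) v = 0" if "Poly_Mapping.keys v \<subseteq> {Y \<in> diagrams k. ?N Y < r}" for r v
    using that
  proof (induction r arbitrary: v)
    case (Suc r)
    have "Poly_Mapping.keys (A i v) \<subseteq> {Y \<in> diagrams k. ?N Y < r}"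
    proof (rule keys_fock_linear[OF moves_linear[OF assms(1)] Suc.prems], rule subsetI)
      fix Y Z assume Y: "Y \<in> {Y \<in> diagrams k. ?N Y < Suc r}"
        and keys: "Z \<in> Poly_Mapping.keys (A i (basis Y))"
      from Y have "Y \<in> diagrams k" by simp
      from assms(1) this keys obtain m
        where Z: "Z \<in> diagrams k" "has_colour n i m" "corner_move \<sigma> m Y Z"
        by (rule moves_keys)
      have "m \<in> {t. wt Y t = \<sigma> \<and> has_colour n i t}"
        using Z by (simp add: corner_move_def)
      then have "?N Z < ?N Y"
        using fin[of Y] Y unfolding corner_move_same_colour(2)[OF assms(1) Z(2,3)]
        by (intro psubset_card_mono) auto
      then show "Z \<in> {Y \<in> diagrams k. ?N Y < r}" using Y Z(1) by simp
    qed
    then show ?case using Suc.IH by (simp add: funpow_swap1)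
  qed simp
  have "?N Y \<le> card (corners n i Y)" if "Y \<in> diagrams k" for Y
    using sign by (intro card_mono finite_corners[OF that]) (auto simp: corners_def)
  then have "Poly_Mapping.keys v \<subseteq> {Y \<in> diagrams k. ?N Y < r}"
    using assms(2,3) unfolding few_corners_def by (blast intro: le_less_trans order_trans)
  then show ?thesis by (rule zero)
qed

lemma moves_adjoint_nilpotent:
  assumes "i \<le> n" "j \<le> n"
  shows "\<exists>B. \<forall>r s v. v \<in> few_corners n k i p \<longrightarrow> r + s \<ge> B \<longrightarrow>
    (A i ^^ r) (A j ((A i ^^ s) v)) = 0"
proof (intro exI allI impI)
  \<comment> \<open>If s > p, the inner power already vanishes. Otherwise r is at least p + 5,
    beyond the bound p + 3 valid after one application of \<open>A j\<close>.\<close>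
  fix r s v assume v: "v \<in> few_corners n k i p" and rs: "r + s \<ge> 2 * p + 5"
  have lin: "fock_linear (A i ^^ r)"
    by (induction r) (auto intro!: fock_linearI simp: fock_linear_simps moves_linear assms)
  show "(A i ^^ r) (A j ((A i ^^ s) v)) = 0"
  proof (cases "s > p")
    case True
    then show ?thesis
      using moves_nilpotent[OF assms(1) v True] by (simp add: fock_linear_simps lin moves_linear assms)
  next
    case False
    have "(A i ^^ s) v \<in> few_corners n k i p"
      by (induction s) (simp_all add: v moves_few_corners_same assms)
    from moves_nilpotent[OF assms(1) moves_few_corners_other[OF assms(2) this], of r]
    show ?thesis using False rs by simp
  qed
qed

end

text \<open>The support is finite, so the sum of its corner numbers bounds each of them.\<close>

lemma Fock_few_corners:
  assumes "v \<in> carrier (Fock k)"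
  obtains p where "v \<in> few_corners n k i p"
proof -
  have "card (corners n i Y) \<le> (\<Sum>Y\<in>Poly_Mapping.keys v. card (corners n i Y))"
    if "Y \<in> Poly_Mapping.keys v" for Y
    using that by (intro member_le_sum) auto
  then show ?thesis using assms that unfolding few_corners_def carrier_Fock by blast
qed

section \<open>Serre elements as iterated twisted commutators\<close>

context adjoint_action
begin

lemma qint_small:
  "qint q (Suc 0) = 1" "qint q 2 = q + inverse q" "qint q 3 = q\<^sup>2 + 1 + (inverse q)\<^sup>2"
proof -
  have *: "x ^ 2 - y ^ 2 = (x + y) * (x - y)" "x ^ 3 - y ^ 3 = (x\<^sup>2 + x * y + y\<^sup>2) * (x - y)"
    for x y :: qfield
    by (simp_all add: power2_eq_square power3_eq_cube algebra_simps)
  show "qint q (Suc 0) = 1" "qint q 2 = q + inverse q" "qint q 3 = q\<^sup>2 + 1 + (inverse q)\<^sup>2"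
    using q_diff_nonzero q_nonzero unfolding qint_def * by simp_all
qed

lemma qint_nonzero:
  assumes "m > 0"
  shows "qint q m \<noteq> 0"
  using powi_diff_inverse_neq_zero[OF q_nonzero q_not_root_of_unity, of "int m"] assms
    q_diff_nonzero
  by (simp add: qint_def power_int_minus power_inverse)

lemma qbinom_small:
  "qbinom q m 0 = 1" "qbinom q m m = 1" "qbinom q 2 (Suc 0) = q + inverse q"
  "qbinom q 3 (Suc 0) = q\<^sup>2 + 1 + (inverse q)\<^sup>2" "qbinom q 3 2 = q\<^sup>2 + 1 + (inverse q)\<^sup>2"
proof -
  have nz: "qfact q m \<noteq> 0" for m
    by (simp add: qfact_def qint_nonzero)
  have fact: "qfact q 0 = 1" "qfact q (Suc 0) = 1" "qfact q 2 = qint q 2"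
    "qfact q 3 = qint q 3 * qint q 2"
    by (simp_all add: qfact_def eval_nat_numeral qint_small(1)[simplified] mult.commute)
  show "qbinom q m 0 = 1" "qbinom q m m = 1"
    using nz by (simp_all add: qbinom_def fact)
  show "qbinom q 2 (Suc 0) = q + inverse q"
    "qbinom q 3 (Suc 0) = q\<^sup>2 + 1 + (inverse q)\<^sup>2" "qbinom q 3 2 = q\<^sup>2 + 1 + (inverse q)\<^sup>2"
    using qint_nonzero[of 2] by (simp_all add: qbinom_def fact qint_small(2,3)[symmetric])
qed

text \<open>The powers of \<open>q\<close> in the iterated twisted commutators cancel exactly when their number
  is \<open>1 - a\<close>.\<close>

lemma serre_eq_ad:
  assumes "a \<in> {0, -1, -2}"
  shows "(\<Sum>r\<le>nat (1 - a). fock_scale ((-1) ^ r * qbinom q (nat (1 - a)) r)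
    ((e ^^ (nat (1 - a) - r)) (x ((e ^^ r) v)))) = ad (nat (1 - a)) v"
proof -
  have cancel: "q * (inverse q * z) = z" "inverse q * (q * z) = z" for z
    using q_nonzero by simp_all
  have ad_Suc: "ad (Suc 0) v = e (x v) - fock_scale (q powi a) (x (e v))"
    "ad (Suc (Suc 0)) v = e (ad (Suc 0) v) - fock_scale (q powi (a + 2)) (ad (Suc 0) (e v))"
    "ad (Suc (Suc (Suc 0))) v =
      e (ad (Suc (Suc 0)) v) - fock_scale (q powi (a + 4)) (ad (Suc (Suc 0)) (e v))" for v
    by simp_all
  note expand = ad_Suc fock_linear_simps linear lookup_add lookup_minus cancel power2_eq_square
    algebra_simps
  \<comment> \<open>Composition with \<open>e\<close> on the left commutes with composition on the
    right, so up to sign the coefficients are the elementary symmetric polynomials of the twists: 1;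
    or q^(-1), q; or q^(-2), 1, q^2. These are the q-binomials.\<close>
  consider "a = 0" | "a = -1" | "a = -2" using assms by auto
  then show ?thesis
  proof cases
    case 1
    then have "nat (1 - a) = Suc 0" "q powi a = 1" by simp_all
    then show ?thesis
      using qbinom_small(1,2)[of "Suc 0"]
      by (intro poly_mapping_eqI) (simp add: expand del: ad.simps)
  next
    case 2
    then have "nat (1 - a) = Suc (Suc 0)" "q powi a = inverse q" "q powi (a + 2) = q"
      by (simp_all add: power_int_minus)
    then show ?thesis
      using qbinom_small(1,2)[of "Suc (Suc 0)"] qbinom_small(3)
      by (intro poly_mapping_eqI) (simp add: expand numeral_2_eq_2 del: ad.simps)
  next
    case 3
    then have "nat (1 - a) = Suc (Suc (Suc 0))" "q powi a = (inverse q)\<^sup>2" "q powi (a + 2) = 1"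
      "q powi (a + 4) = q\<^sup>2"
      by (simp_all add: power_int_minus power_inverse)
    moreover have "qbinom q (Suc (Suc (Suc 0))) (Suc 0) = q\<^sup>2 + 1 + (inverse q)\<^sup>2"
      "qbinom q (Suc (Suc (Suc 0))) (Suc (Suc 0)) = q\<^sup>2 + 1 + (inverse q)\<^sup>2"
      using qbinom_small(4,5) by (simp_all add: numeral_2_eq_2 numeral_3_eq_3)
    ultimately show ?thesis
      using qbinom_small(1,2)[of "Suc (Suc (Suc 0))"]
      by (intro poly_mapping_eqI) (simp add: expand del: ad.simps)
  qed
qed

end

lemma free_act_serre:
  assumes "\<And>a. fock_linear (g a)"
  shows "free_act g (serre n X i j) v = (\<Sum>r\<le>nat (1 - cartan n i j).
    fock_scale ((-1) ^ r * qbinom (q_sub n i) (nat (1 - cartan n i j)) r)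
    ((free_act g (X i) ^^ (nat (1 - cartan n i j) - r)) (free_act g (X j) ((free_act g (X i) ^^ r) v))))"
  by (simp add: serre_def Let_def free_act_sum free_act_mult[OF assms] free_act_power[OF assms])

lemma cartan_values: "i \<noteq> j \<Longrightarrow> cartan n i j \<in> {0, -1, -2}"
  by (simp add: cartan_def)

section \<open>The defining relations as identities on the Fock space\<close>

context
  fixes n k :: nat
  assumes n: "n \<ge> 2"
begin

abbreviation "K_op h \<equiv> gen_op n k (Gen_q h)"

lemma qh_E_op:
  assumes "i \<le> n" "v \<in> carrier (Fock k)"
  shows "K_op h (E_op n i v) = fock_scale (qvar powi simple_root n i h) (E_op n i (K_op h v))"
  by (rule Fock_eqI[OF _ _ _ _ assms(2)])
    (simp_all only: qh_E_basis[OF n assms(1)] linear_op_simps fock.scale_scale mult.commute)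

lemma qh_F_op:
  assumes "i \<le> n" "v \<in> carrier (Fock k)"
  shows "K_op h (F_op n i v) = fock_scale (qvar powi (- simple_root n i h)) (F_op n i (K_op h v))"
  by (rule Fock_eqI[OF _ _ _ _ assms(2)])
    (simp_all only: qh_F_basis[OF n assms(1)] linear_op_simps fock.scale_scale mult.commute)

lemma K_op_add:
  assumes "v \<in> carrier (Fock k)"
  shows "K_op h (K_op h' v) = K_op (h + h') v"
  by (rule Fock_eqI[OF _ _ _ _ assms]) (simp_all add: linear_op_simps power_int_add qvar_nonzero)

lemma K_op_zero:
  assumes "v \<in> carrier (Fock k)"
  shows "K_op 0 v = v"
  by (rule Fock_eqI[OF _ _ _ _ assms]) (simp_all add: linear_op_simps)

lemma ef_commutator:
  assumes "i \<le> n" "j \<le> n" "v \<in> carrier (Fock k)"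
  shows "E_op n i (F_op n j v) - F_op n j (E_op n i v) =
    (if i = j then fock_scale (1 / (q_sub n i - inverse (q_sub n i)))
       (K_op (sym_coroot n i) v - K_op (- sym_coroot n i) v) else 0)"
proof (cases "i = j")
  case True
  have "E_op n i (F_op n i v) - F_op n i (E_op n i v) =
      fock_scale (1 / (q_sub n i - inverse (q_sub n i)))
       (K_op (sym_coroot n i) v - K_op (- sym_coroot n i) v)"
  proof (rule Fock_eqI[OF _ _ _ _ assms(3)])
    fix Y assume "Y \<in> diagrams k"
    moreover have "K_op (sym_coroot n i) (basis Y) - K_op (- sym_coroot n i) (basis Y) =
        Poly_Mapping.single Y (q_sub n i powi wsum (has_colour n i) Y -
          q_sub n i powi (- wsum (has_colour n i) Y))"
      using assms(1) by (simp add: sym_coroot_def pairing_single_H q_sub_powi single_diff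
          flip: single_uminus)
    ultimately show "E_op n i (F_op n i (basis Y)) - F_op n i (E_op n i (basis Y)) =
      fock_scale (1 / (q_sub n i - inverse (q_sub n i)))
       (K_op (sym_coroot n i) (basis Y) - K_op (- sym_coroot n i) (basis Y))"
      by (simp only: ef_commutator_basis[OF n assms(1,1)] fock_scale_single simp_thms if_True)
  qed (simp_all add: linear_op_simps algebra_simps)
  then show ?thesis using True by simp
next
  case False
  have "E_op n i (F_op n j v) = F_op n j (E_op n i v)"
  proof (rule Fock_eqI[OF _ _ _ _ assms(3)])
    fix Y assume "Y \<in> diagrams k"
    from ef_commutator_basis[OF n assms(1,2) this] False
    show "E_op n i (F_op n j (basis Y)) = F_op n j (E_op n i (basis Y))" by simp
  qed (simp_all add: linear_op_simps)
  then show ?thesis using False by simp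
qed

lemma keys_K_op_basis: "Poly_Mapping.keys (K_op h (basis Y)) = {Y}"
  by (simp add: qvar_nonzero)

lemma K_op_Fock: "v \<in> carrier (Fock k) \<Longrightarrow> K_op h v \<in> carrier (Fock k)"
  unfolding carrier_Fock by (rule keys_fock_linear[OF fock_linear_gen_op]) (auto simp: keys_K_op_basis
      simp del: gen_op_simps)

lemma K_op_few_corners: "v \<in> few_corners n k i p \<Longrightarrow> K_op h v \<in> few_corners n k i p"
  by (rule few_corners_keys[OF fock_linear_gen_op]) (auto simp: keys_K_op_basis simp del: gen_op_simps)

lemma gen_op_Fock:
  assumes "a \<in> gens n" "v \<in> carrier (Fock k)"
  shows "gen_op n k a v \<in> carrier (Fock k)"
  using assms K_op_Fock moves_Fock[OF n moves_corners_E_op[OF n]]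
    moves_Fock[OF n moves_corners_F_op[OF n]]
  by (auto simp: gens_def simp del: gen_op_simps(3))

lemma q_sub_simple_root:
  "i \<le> n \<Longrightarrow> qvar powi simple_root n j (sym_coroot n i) = q_sub n i powi cartan n i j"
  "i \<le> n \<Longrightarrow> qvar powi simple_root n j (- sym_coroot n i) = q_sub n i powi (- cartan n i j)"
  "i \<le> n \<Longrightarrow> qvar powi (- simple_root n j (sym_coroot n i)) = q_sub n i powi (- cartan n i j)"
  "i \<le> n \<Longrightarrow> qvar powi (- simple_root n j (- sym_coroot n i)) = q_sub n i powi cartan n i j"
  by (simp_all add: simple_root_uminus sym_coroot_def simple_root_single_H q_sub_powi mult.commute)

lemma K_op_inverse:
  assumes "v \<in> carrier (Fock k)"
  shows "K_op h (K_op (- h) v) = v" "K_op (- h) (K_op h v) = v"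
  by (simp_all only: K_op_add[OF assms] K_op_zero[OF assms] add.left_inverse add.right_inverse)

lemma Fock_diff: "v \<in> carrier (Fock k) \<Longrightarrow> w \<in> carrier (Fock k) \<Longrightarrow> v - w \<in> carrier (Fock k)"
  using Fock_add[of v k "fock_scale (-1) w"] Fock_scale[of w k "-1"] by simp

lemma adjoint_action_E:
  assumes "i \<le> n" "j \<le> n" "i \<noteq> j"
  shows "adjoint_action (E_op n i) (F_op n i) (K_op (sym_coroot n i)) (K_op (- sym_coroot n i))
    (E_op n j) (carrier (Fock k)) (few_corners n k i p) (q_sub n i) (cartan n i j)"
proof -
  note E = moves_corners_E_op[OF n, of k] and F = moves_corners_F_op[OF n, of k]
  have cartan: "cartan n i i = 2" "cartan n i j \<le> 0"
    using cartan_values[OF assms(3), of n] by (auto simp: cartan_def[of n i i])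
  show ?thesis
  proof (rule adjoint_action.intro)
    show "\<exists>B. \<forall>r s v. v \<in> few_corners n k i p \<longrightarrow> B \<le> r + s \<longrightarrow>
        (E_op n i ^^ r) (E_op n j ((E_op n i ^^ s) v)) = 0"
      by (rule moves_adjoint_nilpotent[OF n E _ assms(1,2)]) simp
  next
    fix v assume v: "v \<in> carrier (Fock k)"
    show "E_op n i (F_op n i v) = F_op n i (E_op n i v) +
        fock_scale (1 / (q_sub n i - inverse (q_sub n i)))
          (K_op (sym_coroot n i) v - K_op (- sym_coroot n i) v)"
      using ef_commutator[OF assms(1,1) v] by (simp add: algebra_simps del: gen_op_simps)
    show "E_op n j (F_op n i v) = F_op n i (E_op n j v)"
      using ef_commutator[OF assms(2,1) v] assms(3) by simp
    show "E_op n i v \<in> carrier (Fock k)" "E_op n j v \<in> carrier (Fock k)"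
      "F_op n i v \<in> carrier (Fock k)"
      using v assms moves_Fock[OF n E] moves_Fock[OF n F] by blast+
    show "K_op (sym_coroot n i) v \<in> carrier (Fock k)"
      "K_op (- sym_coroot n i) v \<in> carrier (Fock k)"
      using v by (rule K_op_Fock)+
    show "K_op (- sym_coroot n i) (K_op (sym_coroot n i) v) = v"
      using v by (rule K_op_inverse)
    show "K_op (sym_coroot n i) (E_op n i v) =
        fock_scale (q_sub n i powi 2) (E_op n i (K_op (sym_coroot n i) v))"
      "K_op (- sym_coroot n i) (E_op n i v) =
        fock_scale (q_sub n i powi - 2) (E_op n i (K_op (- sym_coroot n i) v))"
      "K_op (sym_coroot n i) (E_op n j v) =
        fock_scale (q_sub n i powi cartan n i j) (E_op n j (K_op (sym_coroot n i) v))"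
      "K_op (- sym_coroot n i) (E_op n j v) =
        fock_scale (q_sub n i powi - cartan n i j) (E_op n j (K_op (- sym_coroot n i) v))"
      by (simp_all only: qh_E_op[OF assms(1) v] qh_E_op[OF assms(2) v] q_sub_simple_root[OF assms(1)] cartan(1))
  next
    fix v assume "v \<in> few_corners n k i p"
    then show "F_op n i v \<in> few_corners n k i p" "K_op (sym_coroot n i) v \<in> few_corners n k i p"
      using moves_few_corners_same[OF n F _ assms(1)] K_op_few_corners by (simp_all del: gen_op_simps)
  qed (use few_corners_subset cartan(2) in \<open>simp_all only: fock_linear_ops fock_linear_gen_op
      Fock_diff Fock_scale q_sub_nonzero q_sub_powi_neq_one not_False_eq_True\<close>)
qed

text \<open>\<open>K\<close> is now k_i^(-1): conjugation by it multiplies f_i by q_i^2, and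
  [f_i, e_i] = (k_i^(-1) - k_i) / (q_i - q_i^(-1)) has the sign that the locale demands.\<close>

lemma adjoint_action_F:
  assumes "i \<le> n" "j \<le> n" "i \<noteq> j"
  shows "adjoint_action (F_op n i) (E_op n i) (K_op (- sym_coroot n i)) (K_op (sym_coroot n i))
    (F_op n j) (carrier (Fock k)) (few_corners n k i p) (q_sub n i) (cartan n i j)"
proof -
  note E = moves_corners_E_op[OF n, of k] and F = moves_corners_F_op[OF n, of k]
  have cartan: "cartan n i i = 2" "cartan n i j \<le> 0"
    using cartan_values[OF assms(3), of n] by (auto simp: cartan_def[of n i i])
  show ?thesis
  proof (rule adjoint_action.intro)
    show "\<exists>B. \<forall>r s v. v \<in> few_corners n k i p \<longrightarrow> B \<le> r + s \<longrightarrow>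
        (F_op n i ^^ r) (F_op n j ((F_op n i ^^ s) v)) = 0"
      by (rule moves_adjoint_nilpotent[OF n F _ assms(1,2)]) simp
  next
    fix v assume v: "v \<in> carrier (Fock k)"
    show "F_op n i (E_op n i v) = E_op n i (F_op n i v) +
        fock_scale (1 / (q_sub n i - inverse (q_sub n i)))
          (K_op (- sym_coroot n i) v - K_op (sym_coroot n i) v)"
      using ef_commutator[OF assms(1,1) v]
      by (simp add: algebra_simps fock.scale_right_diff_distrib del: gen_op_simps)
    show "F_op n j (E_op n i v) = E_op n i (F_op n j v)"
      using ef_commutator[OF assms(1,2) v] assms(3) by simp
    show "F_op n i v \<in> carrier (Fock k)" "F_op n j v \<in> carrier (Fock k)"
      "E_op n i v \<in> carrier (Fock k)"
      using v assms moves_Fock[OF n E] moves_Fock[OF n F] by blast+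
    show "K_op (- sym_coroot n i) v \<in> carrier (Fock k)"
      "K_op (sym_coroot n i) v \<in> carrier (Fock k)"
      using v by (rule K_op_Fock)+
    show "K_op (sym_coroot n i) (K_op (- sym_coroot n i) v) = v"
      using v by (rule K_op_inverse)
    show "K_op (- sym_coroot n i) (F_op n i v) =
        fock_scale (q_sub n i powi 2) (F_op n i (K_op (- sym_coroot n i) v))"
      "K_op (sym_coroot n i) (F_op n i v) =
        fock_scale (q_sub n i powi - 2) (F_op n i (K_op (sym_coroot n i) v))"
      "K_op (- sym_coroot n i) (F_op n j v) =
        fock_scale (q_sub n i powi cartan n i j) (F_op n j (K_op (- sym_coroot n i) v))"
      "K_op (sym_coroot n i) (F_op n j v) =
        fock_scale (q_sub n i powi - cartan n i j) (F_op n j (K_op (sym_coroot n i) v))"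
      by (simp_all only: qh_F_op[OF assms(1) v] qh_F_op[OF assms(2) v] q_sub_simple_root[OF assms(1)] cartan(1))
  next
    fix v assume "v \<in> few_corners n k i p"
    then show "E_op n i v \<in> few_corners n k i p" "K_op (- sym_coroot n i) v \<in> few_corners n k i p"
      using moves_few_corners_same[OF n E _ assms(1)] K_op_few_corners by (simp_all del: gen_op_simps)
  qed (use few_corners_subset cartan(2) in \<open>simp_all only: fock_linear_ops fock_linear_gen_op
      Fock_diff Fock_scale q_sub_nonzero q_sub_powi_neq_one not_False_eq_True\<close>)
qed

text \<open>The bound p depends on v, so the locale is interpreted separately for each
  vector.\<close>

lemma serre_E:
  assumes "i \<le> n" "j \<le> n" "i \<noteq> j" "v \<in> carrier (Fock k)"
  shows "free_act (gen_op n k) (serre n (\<lambda>i. X_e i) i j) v = 0"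
proof -
  obtain p where p: "v \<in> few_corners n k i p" using assms(4) by (rule Fock_few_corners)
  interpret adjoint_action "E_op n i" "F_op n i" "K_op (sym_coroot n i)" "K_op (- sym_coroot n i)"
    "E_op n j" "carrier (Fock k)" "few_corners n k i p" "q_sub n i" "cartan n i j"
    by (rule adjoint_action_E[OF assms(1-3)])
  have "free_act (gen_op n k) (X_e i) = E_op n i" for i by (rule ext) simp
  then show ?thesis
    using serre_eq_ad[OF cartan_values[OF assms(3)], of v] ad_vanishes[OF p]
    by (simp add: free_act_serre[OF fock_linear_gen_op])
qed

lemma serre_F:
  assumes "i \<le> n" "j \<le> n" "i \<noteq> j" "v \<in> carrier (Fock k)"
  shows "free_act (gen_op n k) (serre n (\<lambda>i. X_f i) i j) v = 0"
proof -
  obtain p where p: "v \<in> few_corners n k i p" using assms(4) by (rule Fock_few_corners)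
  interpret adjoint_action "F_op n i" "E_op n i" "K_op (- sym_coroot n i)" "K_op (sym_coroot n i)"
    "F_op n j" "carrier (Fock k)" "few_corners n k i p" "q_sub n i" "cartan n i j"
    by (rule adjoint_action_F[OF assms(1-3)])
  have "free_act (gen_op n k) (X_f i) = F_op n i" for i by (rule ext) simp
  then show ?thesis
    using serre_eq_ad[OF cartan_values[OF assms(3)], of v] ad_vanishes[OF p]
    by (simp add: free_act_serre[OF fock_linear_gen_op])
qed

lemma relators_act_zero:
  assumes "p \<in> relators n" "v \<in> carrier (Fock k)"
  shows "free_act (gen_op n k) p v = 0"
proof -
  note [simp] = free_act_diff free_act_mult[OF fock_linear_gen_op]
  from assms(1) consider
    "p = X_q 0 - 1"
    | h h' where "p = X_q h * X_q h' - X_q (h + h')"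
    | h i where "i \<le> n" "p = X_q h * X_e i * X_q (- h) - scal (qvar powi simple_root n i h) * X_e i"
    | h i where "i \<le> n" "p = X_q h * X_f i * X_q (- h) - scal (qvar powi (- simple_root n i h)) * X_f i"
    | i j where "i \<le> n" "j \<le> n" "p = X_e i * X_f j - X_f j * X_e i -
        (if i = j
         then scal (1 / (q_sub n i - inverse (q_sub n i))) *
              (X_q (sym_coroot n i) - X_q (- sym_coroot n i))
         else 0)"
    | i j where "i \<le> n" "j \<le> n" "i \<noteq> j" "p = serre n (\<lambda>i. X_e i) i j"
    | i j where "i \<le> n" "j \<le> n" "i \<noteq> j" "p = serre n (\<lambda>i. X_f i) i j"
    unfolding relators_def by blast
  then show ?thesis
  proof cases
    case 1
    then show ?thesis using K_op_zero[OF assms(2)] by simp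
  next
    case 2
    then show ?thesis using K_op_add[OF assms(2)] by (simp del: gen_op_simps)
  next
    case (3 h i)
    then show ?thesis
      \<comment> \<open>The commutation rule is evaluated at q^(-h) v, after which q^h and q^(-h)
        cancel.\<close>
      using qh_E_op[OF _ K_op_Fock[OF assms(2)]] K_op_inverse[OF assms(2)]
      by (simp del: gen_op_simps(3))
  next
    case (4 h i)
    then show ?thesis
      using qh_F_op[OF _ K_op_Fock[OF assms(2)]] K_op_inverse[OF assms(2)]
      by (simp del: gen_op_simps(3))
  next
    case (5 i j)
    then show ?thesis
      using ef_commutator[OF 5(1,2) assms(2)] by (simp del: gen_op_simps(3) split: if_splits)
  next
    case 6
    then show ?thesis using serre_E assms(2) by simp
  next
    case 7
    then show ?thesis using serre_F assms(2) by simp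
  qed
qed

lemma qh_op_eq:
  assumes "i \<le> n" "v \<in> carrier (Fock k)"
  shows "K_op (coroot i) v = qh_op n i v"
proof (rule Fock_eqI[OF _ _ _ _ assms(2)])
  show "K_op (coroot i) (basis Y) = qh_op n i (basis Y)" if "Y \<in> diagrams k" for Y
    using assms(1) by (simp add: qh_op_def pairing_single_H cc_minus_cx[OF that])
qed (simp_all add: qh_op_def linear_op_simps)

text \<open>Over all sites of colour i the exponent of q_i is the full signed corner count, and q_i
  = q^(s_i) turns it into the pairing with s_i h_i.\<close>

lemma T_op_eq:
  assumes "i \<le> n" "v \<in> carrier (Fock k)"
  shows "K_op (sym_coroot n i) v = T_op n i v"
proof (rule Fock_eqI[OF _ _ _ _ assms(2)])
  show "K_op (sym_coroot n i) (basis Y) = T_op n i (basis Y)" if "Y \<in> diagrams k" for Y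
    using assms(1) T_prod_single[OF n assms(1) that, of 1 "\<lambda>_. True" 1]
    by (simp add: T_op_def sym_coroot_def pairing_single_H q_sub_powi)
qed (simp_all add: T_op_def T_prod_def linear_op_simps)

lemma Td_op_eq: "K_op coweight_d = Td_op n k"
  by (simp add: Td_op_def pairing_single_D)

end

theorem theorem2p3:
  fixes n k :: nat
  assumes "n \<ge> 2" and "k \<le> n"
  shows "\<exists>act :: free_elem set \<Rightarrow> fock \<Rightarrow> fock.
    algebra_module Qq (Uq n) (Fock k) act \<and>
    (\<forall>v \<in> carrier (Fock k).
       (\<forall>i\<le>n. act (Ue n i) v = E_op n i v \<and>
              act (Uf n i) v = F_op n i v \<and>
              act (Uqh n (coroot i)) v = qh_op n i v \<and>
              act (Uk n i) v = T_op n i v) \<and>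
       act (Uqh n coweight_d) v = Td_op n k v)"
proof -
  obtain act where act: "algebra_module Qq (Uq n) (Fock k) act"
    and gen: "\<And>a v. a \<in> gens n \<Longrightarrow> v \<in> carrier (Fock k) \<Longrightarrow>
      act (U_class n (gen_elem a)) v = gen_op n k a v"
    using relations_imp_algebra_module[of "gen_op n k" n k, OF fock_linear_gen_op
        gen_op_Fock[OF assms(1)] relators_act_zero[OF assms(1)]] by blast
  have "Gen_e i \<in> gens n" "Gen_f i \<in> gens n" "Gen_q (coroot i) \<in> gens n"
    "Gen_q (sym_coroot n i) \<in> gens n" if "i \<le> n" for i
    using that by (auto simp: gens_def coweights_def sym_coroot_def)
  moreover have "Gen_q coweight_d \<in> gens n"
    by (auto simp: gens_def coweights_def)
  ultimately show ?thesis
    using act gen qh_op_eq[OF assms(1)] T_op_eq[OF assms(1)] Td_op_eq[OF assms(1), of k, THEN fun_cong]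
    by (intro exI[of _ act]) (auto simp: Ue_def Uf_def Uqh_def Uk_def simp del: gen_op_simps(3))
qed

end
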